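(* Let $L,\rho_1,\rho_2,\kappa,b,k_0,\ell>0$ and $\gamma_1,\gamma_2,\gamma_3>0$ be constants, and let $\{\mathcal{S}_{\mathcal{A}}(t)\}_{t\ge0}$ be the contraction semigroup on $\mathcal{H}$ generated by the operator $\mathcal{A}$ defined in the context. Then the semigroup is exponentially stable: there exist constants $M>0$ and $\mu>0$ such that $\|\mathcal{S}_{\mathcal{A}}(t)\|_{\mathcal{L}(\mathcal{H})}\le M e^{-\mu t}$ for all $t\ge0$.
   Context: Let $H^1_L(0,L)=\{\phi\in H^1(0,L):\ \phi(L)=0\}$ (complex-valued functions), and let $\|\cdot\|$ denote the $L^2(0,L)$ norm. Let $\mathcal{H}=[H^1_L(0,L)]^3\times[L^2(0,L)]^3$, whose elements are written $U=(\varphi,\psi,w,\Phi,\Psi,W)$, equipped with the Hilbert norm $\|U\|_{\mathcal{H}}^2=\kappa\|\varphi_x+\psi+\ell w\|^2+\rho_1\|\Phi\|^2+b\|\psi_x\|^2+\rho_2\|\Psi\|^2+\rho_1\|W\|^2+k_0\|w_x-\ell\varphi\|^2$. Define $\mathcal{D}(\mathcal{A})=\{U\in\mathcal{H}:\ \varphi,\psi,w\in H^2(0,L),\ \Phi,\Psi,W\in H^1_L(0,L),\ \kappa(\varphi_x+\psi+\ell w)(0)=\gamma_1\Phi(0),\ b\psi_x(0)=\gamma_2\Psi(0),\ k_0(w_x-\ell\varphi)(0)=\gamma_3 W(0)\}$ and $\mathcal{A}U=\Big(\Phi,\ \Psi,\ W,\ \tfrac{\kappa}{\rho_1}(\varphi_x+\psi+\ell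 w)_x+\tfrac{k_0\ell}{\rho_1}(w_x-\ell\varphi),\ \tfrac{b}{\rho_2}\psi_{xx}-\tfrac{\kappa}{\rho_2}(\varphi_x+\psi+\ell w),\ \tfrac{k_0}{\rho_1}(w_x-\ell\varphi)_x-\tfrac{\kappa\ell}{\rho_1}(\varphi_x+\psi+\ell w)\Big)$. This is the first-order formulation of the Bresse system $\rho_1\varphi_{tt}-\kappa(\varphi_x+\psi+\ell w)_x-k_0\ell(w_x-\ell\varphi)=0$, $\rho_2\psi_{tt}-b\psi_{xx}+\kappa(\varphi_x+\psi+\ell w)=0$, $\rho_1 w_{tt}-k_0(w_x-\ell\varphi)_x+\kappa\ell(\varphi_x+\psi+\ell w)=0$ on $(0,L)$, with $\varphi=\psi=w=0$ at $x=L$ and boundary dissipation $\kappa(\varphi_x+\psi+\ell w)(0)=\gamma_1\varphi_t(0)$, $b\psi_x(0)=\gamma_2\psi_t(0)$, $k_0(w_x-\ell\varphi)(0)=\gamma_3 w_t(0)$; $\mathcal{A}$ generates a $C_0$-semigroup of contractions on $\mathcal{H}$. *)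

theory Defs
  imports "HOL-Analysis.Analysis"
begin

text \<open>Complex-valued functions on the reals; only their restriction to [0,L] matters.
  L^2(0,L) is modelled by functions modulo null sets: all norms below are seminorms
  on representatives, and all identities of the semigroup theory are required only
  up to sets of measure zero (i.e. up to vanishing norm).\<close>

type_synonym cfun = "real \<Rightarrow> complex"
type_synonym state = "cfun \<times> cfun \<times> cfun \<times> cfun \<times> cfun \<times> cfun"

definition L2 :: "real \<Rightarrow> cfun \<Rightarrow> bool" where
  "L2 L f \<longleftrightarrow> set_borel_measurable lborel {0..L} f \<and>
     set_integrable lborel {0..L} (\<lambda>x. (cmod (f x))^2)"

definition l2norm :: "real \<Rightarrow> cfun \<Rightarrow> real" where
  "l2norm L f = sqrt (LINT x:{0..L}|lborel. (cmod (f x))^2)"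

text \<open>g is a weak derivative of f on (0,L) in L^2, with f the absolutely continuous
  representative on [0,L].\<close>
definition is_wderiv :: "real \<Rightarrow> cfun \<Rightarrow> cfun \<Rightarrow> bool" where
  "is_wderiv L f g \<longleftrightarrow> L2 L g \<and> (\<forall>x\<in>{0..L}. f x = f 0 + (LINT t:{0..x}|lborel. g t))"

definition H1 :: "real \<Rightarrow> cfun \<Rightarrow> bool" where
  "H1 L f \<longleftrightarrow> (\<exists>g. is_wderiv L f g)"

definition H1L :: "real \<Rightarrow> cfun \<Rightarrow> bool" where
  "H1L L f \<longleftrightarrow> H1 L f \<and> f L = 0"

definition H2 :: "real \<Rightarrow> cfun \<Rightarrow> bool" where
  "H2 L f \<longleftrightarrow> (\<exists>g h. is_wderiv L f g \<and> is_wderiv L g h)"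

definition wd :: "real \<Rightarrow> cfun \<Rightarrow> cfun" where
  "wd L f = (SOME g. is_wderiv L f g)"

definition wd2 :: "real \<Rightarrow> cfun \<Rightarrow> cfun" where
  "wd2 L f = (SOME h. \<exists>g. is_wderiv L f g \<and> is_wderiv L g h)"

text \<open>value at x = 0 of the continuous representative of the derivative of an H^2 function\<close>
definition dval0 :: "real \<Rightarrow> cfun \<Rightarrow> complex" where
  "dval0 L f = (SOME c. \<exists>g h. is_wderiv L f g \<and> is_wderiv L g h \<and> g 0 = c)"

definition st_add :: "state \<Rightarrow> state \<Rightarrow> state" where
  "st_add U V = (case U of (u1,u2,u3,u4,u5,u6) \<Rightarrow> case V of (v1,v2,v3,v4,v5,v6) \<Rightarrow>
     (\<lambda>x. u1 x + v1 x, \<lambda>x. u2 x + v2 x, \<lambda>x. u3 x + v3 x,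
      \<lambda>x. u4 x + v4 x, \<lambda>x. u5 x + v5 x, \<lambda>x. u6 x + v6 x))"

definition st_scale :: "complex \<Rightarrow> state \<Rightarrow> state" where
  "st_scale c U = (case U of (u1,u2,u3,u4,u5,u6) \<Rightarrow>
     (\<lambda>x. c * u1 x, \<lambda>x. c * u2 x, \<lambda>x. c * u3 x,
      \<lambda>x. c * u4 x, \<lambda>x. c * u5 x, \<lambda>x. c * u6 x))"

definition st_sub :: "state \<Rightarrow> state \<Rightarrow> state" where
  "st_sub U V = st_add U (st_scale (-1) V)"

definition Hspace :: "real \<Rightarrow> state set" where
  "Hspace L = {(\<phi>,\<psi>,w,\<Phi>,\<Psi>,W). H1L L \<phi> \<and> H1L L \<psi> \<and> H1L L w \<and> L2 L \<Phi> \<and> L2 L \<Psi> \<and> L2 L W}"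

definition Hnorm :: "real \<Rightarrow> real \<Rightarrow> real \<Rightarrow> real \<Rightarrow> real \<Rightarrow> real \<Rightarrow> real \<Rightarrow> state \<Rightarrow> real" where
  "Hnorm L rho1 rho2 kap b k0 l U = (case U of (\<phi>,\<psi>,w,\<Phi>,\<Psi>,W) \<Rightarrow>
     sqrt (kap * (l2norm L (\<lambda>x. wd L \<phi> x + \<psi> x + complex_of_real l * w x))^2
         + rho1 * (l2norm L \<Phi>)^2
         + b * (l2norm L (wd L \<psi>))^2
         + rho2 * (l2norm L \<Psi>)^2
         + rho1 * (l2norm L W)^2
         + k0 * (l2norm L (\<lambda>x. wd L w x - complex_of_real l * \<phi> x))^2))"

definition DA :: "real \<Rightarrow> real \<Rightarrow> real \<Rightarrow> real \<Rightarrow> real \<Rightarrow> real \<Rightarrow> real \<Rightarrow> real \<Rightarrow> state set" where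
  "DA L kap b k0 l g1 g2 g3 = {(\<phi>,\<psi>,w,\<Phi>,\<Psi>,W). (\<phi>,\<psi>,w,\<Phi>,\<Psi>,W) \<in> Hspace L \<and>
     H2 L \<phi> \<and> H2 L \<psi> \<and> H2 L w \<and> H1L L \<Phi> \<and> H1L L \<Psi> \<and> H1L L W \<and>
     complex_of_real kap * (dval0 L \<phi> + \<psi> 0 + complex_of_real l * w 0) = complex_of_real g1 * \<Phi> 0 \<and>
     complex_of_real b * dval0 L \<psi> = complex_of_real g2 * \<Psi> 0 \<and>
     complex_of_real k0 * (dval0 L w - complex_of_real l * \<phi> 0) = complex_of_real g3 * W 0}"

definition Aop :: "real \<Rightarrow> real \<Rightarrow> real \<Rightarrow> real \<Rightarrow> real \<Rightarrow> real \<Rightarrow> real \<Rightarrow> state \<Rightarrow> state" where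
  "Aop L rho1 rho2 kap b k0 l U = (case U of (\<phi>,\<psi>,w,\<Phi>,\<Psi>,W) \<Rightarrow>
     (\<Phi>, \<Psi>, W,
      \<lambda>x. complex_of_real (kap / rho1) * (wd2 L \<phi> x + wd L \<psi> x + complex_of_real l * wd L w x)
          + complex_of_real (k0 * l / rho1) * (wd L w x - complex_of_real l * \<phi> x),
      \<lambda>x. complex_of_real (b / rho2) * wd2 L \<psi> x
          - complex_of_real (kap / rho2) * (wd L \<phi> x + \<psi> x + complex_of_real l * w x),
      \<lambda>x. complex_of_real (k0 / rho1) * (wd2 L w x - complex_of_real l * wd L \<phi> x)
          - complex_of_real (kap * l / rho1) * (wd L \<phi> x + \<psi> x + complex_of_real l * w x)))"

definition C0_contraction_semigroup ::
    "state set \<Rightarrow> (state \<Rightarrow> real) \<Rightarrow> (real \<Rightarrow> state \<Rightarrow> state) \<Rightarrow> bool" where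
  "C0_contraction_semigroup X N S \<longleftrightarrow>
     (\<forall>t\<ge>0. \<forall>U\<in>X. S t U \<in> X) \<and>
     (\<forall>t\<ge>0. \<forall>U\<in>X. \<forall>V\<in>X. \<forall>c. N (st_sub (S t (st_add U (st_scale c V)))
                                     (st_add (S t U) (st_scale c (S t V)))) = 0) \<and>
     (\<forall>t\<ge>0. \<forall>U\<in>X. N (S t U) \<le> N U) \<and>
     (\<forall>U\<in>X. N (st_sub (S 0 U) U) = 0) \<and>
     (\<forall>t\<ge>0. \<forall>s\<ge>0. \<forall>U\<in>X. N (st_sub (S (t + s) U) (S t (S s U))) = 0) \<and>
     (\<forall>U\<in>X. ((\<lambda>t. N (st_sub (S t U) U)) \<longlongrightarrow> 0) (at_right 0))"

definition has_generator ::
    "state set \<Rightarrow> (state \<Rightarrow> real) \<Rightarrow> (real \<Rightarrow> state \<Rightarrow> state) \<Rightarrow> state set \<Rightarrow> (state \<Rightarrow> state) \<Rightarrow> bool" where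
  "has_generator X N S D A \<longleftrightarrow> D \<subseteq> X \<and> (\<forall>U\<in>D. A U \<in> X) \<and>
     (\<forall>U\<in>D. ((\<lambda>h. N (st_sub (st_scale (complex_of_real (1 / h)) (st_sub (S h U) U)) (A U)))
                \<longlongrightarrow> 0) (at_right 0)) \<and>
     (\<forall>U\<in>X. \<forall>V\<in>X.
        ((\<lambda>h. N (st_sub (st_scale (complex_of_real (1 / h)) (st_sub (S h U) U)) V)) \<longlongrightarrow> 0) (at_right 0)
        \<longrightarrow> (\<exists>U'\<in>D. N (st_sub U U') = 0 \<and> N (st_sub (A U') V) = 0))"

end

theory Submission
  imports Defs
begin

text \<open>Put \<open>u = \<phi>\<^sub>x + \<psi> + l w\<close>, \<open>v = \<psi>\<^sub>x\<close>, \<open>z = w\<^sub>x - l \<phi>\<close>. The energy density \<open>e\<close> is a quadratic form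
  in \<open>(u,\<Phi>,v,\<Psi>,z,W)\<close>, and these six functions satisfy a closed first-order system, so that
  no compactness argument is needed to absorb lower order terms: with
  \<open>q = 2 Re (rho1 \<Phi> u\<^sup>* + rho2 \<Psi> v\<^sup>* + rho1 W z\<^sup>*)\<close> one has \<open>q\<^sub>t = e\<^sub>x + R\<close> with
  \<open>\<bar>R\<bar> \<le> C0 e\<close>. The weight \<open>m(x) = 1 - exp (C0 (L - x))\<close> satisfies \<open>m(L) = 0\<close> and \<open>m' = C0 (\<bar>m\<bar> + 1)\<close>,
  hence \<open>d/dt \<integral> m q \<le> \<bar>m(0)\<bar> e(0) - C0 \<integral> e\<close>. All three boundary conditions at \<open>0\<close> are dissipative,
  so \<open>e(0)\<close> is controlled by the loss of energy, and \<open>\<integral> (e + eps m q)\<close> is a strict Lyapunov functional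
  equivalent to the energy when \<open>eps\<close> is small. Along orbits of the semigroup that start in the domain
  the decay follows from an Euler-type iteration of the resulting one-step inequality; the domain is dense.\<close>

section \<open>Square-integrable functions on an interval\<close>

text \<open>Chosen derivatives and the semigroup law are fixed only up to null sets, and velocities
  have no point values along an orbit. \<open>T\<close> therefore maps a state to its energy
  variables, scaled so that the norm of the state space becomes the plain L^2 norm of a function
  with values in C^6; the semigroup axioms turn into almost-everywhere identities for
  \<open>T\<close>. Boundary values are used only for domain elements, through continuous
  representatives. The generator is known only through one-sided difference quotients at time 0, so
  the dissipation inequality is proved for a single domain element, as a relation between
  \<open>T U\<close> and \<open>T (A U)\<close>, and is then carried along the orbit in small time
  steps whose error bound does not depend on time. The weight has to vanish at L because the
  strains, unlike the velocities, are free there. Weak derivatives are given by an integral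
  equation, so the product rule behind integration by parts is first derived from Fubini's
  theorem.\<close>

abbreviation leb0 :: "real \<Rightarrow> real measure" where
  "leb0 L \<equiv> restrict_space lborel {0..L}"

lemma leb0_sets [measurable_cong]: "sets (leb0 L) = sets (restrict_space borel {0..L})"
  by (rule sets_restrict_space_cong) simp

lemma finite_measure_leb0: "finite_measure (leb0 L)"
  by (rule finite_measureI) (simp add: emeasure_restrict_space space_restrict_space emeasure_lborel_Icc_eq)

lemma integral_leb0:
  fixes f :: "real \<Rightarrow> 'a::{banach, second_countable_topology}"
  shows "(LINT x:{0..L}|lborel. f x) = integral\<^sup>L (leb0 L) f"
  by (simp add: set_lebesgue_integral_def integral_restrict_space)

lemma integrable_leb0:
  fixes f :: "real \<Rightarrow> 'a::{banach, second_countable_topology}"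
  shows "set_integrable lborel {0..L} f \<longleftrightarrow> integrable (leb0 L) f"
  by (simp add: set_integrable_def integrable_restrict_space)

text \<open>The moving upper limit becomes an indicator inside an integral over a fixed finite
  measure, the form in which Fubini's theorem and termwise linearity can be applied.\<close>

lemma integral_leb0_upto:
  fixes f :: "real \<Rightarrow> 'a::{banach, second_countable_topology}"
  assumes "x \<in> {0..L}"
  shows "(LINT t:{0..x}|lborel. f t) = integral\<^sup>L (leb0 L) (\<lambda>t. indicat_real {..x} t *\<^sub>R f t)"
  unfolding set_lebesgue_integral_def
  by (subst integral_restrict_space, simp, rule Bochner_Integration.integral_cong)
     (use assms in \<open>auto simp: indicator_def\<close>)

lemma AE_leb0: "(AE x in leb0 L. P x) \<longleftrightarrow> (AE x in lborel. x \<in> {0..L} \<longrightarrow> P x)"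
  by (rule AE_restrict_space_iff) simp

text \<open>Any Euclidean target is allowed because the notion serves both the complex components
  and the six-component energy vector.\<close>

definition sqint :: "real \<Rightarrow> (real \<Rightarrow> 'a::euclidean_space) \<Rightarrow> bool" where
  "sqint L f \<longleftrightarrow> f \<in> borel_measurable (leb0 L) \<and> integrable (leb0 L) (\<lambda>x. (norm (f x))\<^sup>2)"

lemma L2_sqint: "L2 L f \<longleftrightarrow> sqint L f"
  by (simp add: L2_def sqint_def set_borel_measurable_def integrable_leb0 borel_measurable_restrict_space_iff)

lemma sqint_integrable:
  assumes "sqint L f"
  shows "integrable (leb0 L) f"
proof -
  interpret finite_measure "leb0 L" by (rule finite_measure_leb0)
  have [measurable]: "f \<in> borel_measurable (leb0 L)" and i: "integrable (leb0 L) (\<lambda>x. (norm (f x))\<^sup>2)"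
    using assms by (auto simp: sqint_def)
  have "integrable (leb0 L) (\<lambda>x. 1 + (norm (f x))\<^sup>2)" using i by simp
  then show ?thesis
  proof (rule Bochner_Integration.integrable_bound)
    show "AE x in leb0 L. norm (f x) \<le> norm (1 + (norm (f x))\<^sup>2)"
    proof (rule AE_I2)
      fix x
      have "0 \<le> (norm (f x) - 1)\<^sup>2" by simp
      then show "norm (f x) \<le> norm (1 + (norm (f x))\<^sup>2)"
        unfolding real_norm_def power2_diff by (smt (verit) norm_ge_zero power_one zero_le_power2)
    qed
  qed simp
qed

lemma sqint_bound:
  assumes "g \<in> borel_measurable (leb0 L)" "sqint L f"
    "\<And>x. x \<in> {0..L} \<Longrightarrow> norm (g x) \<le> C * norm (f x)"
  shows "sqint L g"
  unfolding sqint_def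
proof
  have [measurable]: "g \<in> borel_measurable (leb0 L)" by fact
  have i: "integrable (leb0 L) (\<lambda>x. C\<^sup>2 * (norm (f x))\<^sup>2)"
    using assms(2) by (simp add: sqint_def)
  then show "integrable (leb0 L) (\<lambda>x. (norm (g x))\<^sup>2)"
  proof (rule Bochner_Integration.integrable_bound)
    show "AE x in leb0 L. norm ((norm (g x))\<^sup>2) \<le> norm (C\<^sup>2 * (norm (f x))\<^sup>2)"
    proof (rule AE_I2)
      fix x assume "x \<in> space (leb0 L)"
      then have "norm (g x) \<le> C * norm (f x)" using assms(3) by (simp add: space_restrict_space)
      then have "(norm (g x))\<^sup>2 \<le> (C * norm (f x))\<^sup>2" by (intro power_mono) auto
      then show "norm ((norm (g x))\<^sup>2) \<le> norm (C\<^sup>2 * (norm (f x))\<^sup>2)" by (simp add: power_mult_distrib)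
    qed
  qed simp
qed (fact assms(1))

lemma sqint_measurable: "sqint L f \<Longrightarrow> f \<in> borel_measurable (leb0 L)"
  by (simp add: sqint_def)

lemma sqint_add:
  assumes "sqint L f" "sqint L g"
  shows "sqint L (\<lambda>x. f x + g x)"
  unfolding sqint_def
proof
  note [measurable] = assms[THEN sqint_measurable]
  show "(\<lambda>x. f x + g x) \<in> borel_measurable (leb0 L)" by measurable
  have "integrable (leb0 L) (\<lambda>x. 2 * (norm (f x))\<^sup>2 + 2 * (norm (g x))\<^sup>2)"
    using assms by (auto simp: sqint_def)
  then show "integrable (leb0 L) (\<lambda>x. (norm (f x + g x))\<^sup>2)"
  proof (rule Bochner_Integration.integrable_bound)
    show "AE x in leb0 L. norm ((norm (f x + g x))\<^sup>2) \<le> norm (2 * (norm (f x))\<^sup>2 + 2 * (norm (g x))\<^sup>2)"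
    proof (rule AE_I2)
      fix x
      have "(norm (f x + g x))\<^sup>2 \<le> (norm (f x) + norm (g x))\<^sup>2"
        by (intro power_mono norm_triangle_ineq) auto
      also have "\<dots> \<le> 2 * (norm (f x))\<^sup>2 + 2 * (norm (g x))\<^sup>2"
        using sum_squares_bound[of "norm (f x)" "norm (g x)"] by (simp add: power2_sum)
      finally show "norm ((norm (f x + g x))\<^sup>2) \<le> norm (2 * (norm (f x))\<^sup>2 + 2 * (norm (g x))\<^sup>2)"
        by simp
    qed
  qed measurable
qed

lemma sqint_bounded_linear:
  fixes h :: "'a::euclidean_space \<Rightarrow> 'b::euclidean_space"
  assumes "bounded_linear h" "sqint L f"
  shows "sqint L (\<lambda>x. h (f x))"
proof -
  obtain K where K: "\<And>y. norm (h y) \<le> norm y * K"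
    using bounded_linear.bounded[OF assms(1)] by blast
  have [measurable]: "h \<in> borel_measurable borel"
    using assms(1) by (intro borel_measurable_continuous_onI linear_continuous_on)
  note [measurable] = assms(2)[THEN sqint_measurable]
  show ?thesis by (rule sqint_bound[OF _ assms(2), where C = K]) (use K in \<open>auto simp: mult.commute\<close>)
qed

lemma sqint_diff:
  assumes "sqint L f" "sqint L g"
  shows "sqint L (\<lambda>x. f x - g x)"
  using sqint_add[OF assms(1) sqint_bounded_linear[OF bounded_linear_minus[OF bounded_linear_ident] assms(2)]]
  by simp

lemma sqint_scaleR: "sqint L f \<Longrightarrow> sqint L (\<lambda>x. c *\<^sub>R f x)"
  by (rule sqint_bounded_linear[OF bounded_linear_scaleR_right])

lemma sqint_mult: "sqint L f \<Longrightarrow> sqint L (\<lambda>x. (c::complex) * f x)"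
  by (rule sqint_bounded_linear[OF bounded_linear_mult_right])

lemma sqint_mult_bounded:
  fixes f g :: cfun
  assumes "f \<in> borel_measurable (leb0 L)" "\<And>x. x \<in> {0..L} \<Longrightarrow> norm (f x) \<le> C" "sqint L g"
  shows "sqint L (\<lambda>x. f x * g x)"
proof -
  note [measurable] = assms(1) assms(3)[THEN sqint_measurable]
  show ?thesis
    by (rule sqint_bound[OF _ assms(3), where C = C]) (use assms(2) in \<open>auto simp: norm_mult intro: mult_right_mono\<close>)
qed

lemma sqint_const: "sqint L (\<lambda>_. c)"
  unfolding sqint_def
proof -
  interpret finite_measure "leb0 L" by (rule finite_measure_leb0)
  show "(\<lambda>_. c) \<in> borel_measurable (leb0 L) \<and> integrable (leb0 L) (\<lambda>x. (norm c)\<^sup>2)" by simp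
qed

lemma sqint_bounded:
  assumes "f \<in> borel_measurable (leb0 L)" "\<And>x. x \<in> {0..L} \<Longrightarrow> norm (f x) \<le> C"
  shows "sqint L f"
  by (rule sqint_bound[OF assms(1) sqint_const[of _ "1::real"], where C = C]) (use assms(2) in auto)

lemma continuous_leb0_measurable: "continuous_on {0..L} f \<Longrightarrow> f \<in> borel_measurable (leb0 L)"
  using borel_measurable_continuous_on_restrict[of "{0..L}" f] measurable_cong_sets[OF leb0_sets[symmetric]] by blast

lemma continuous_bounded:
  fixes f :: "real \<Rightarrow> 'a::real_normed_vector"
  assumes "continuous_on {0..L} f"
  obtains C where "C > 0" "\<And>x. x \<in> {0..L} \<Longrightarrow> norm (f x) \<le> C"
  using compact_imp_bounded[OF compact_continuous_image[OF assms compact_Icc]]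
  by (auto simp: bounded_pos)

lemma continuous_sqint:
  fixes f :: "real \<Rightarrow> 'a::euclidean_space"
  assumes "continuous_on {0..L} f" shows "sqint L f"
  using continuous_bounded[OF assms] sqint_bounded[OF continuous_leb0_measurable[OF assms]] by metis

lemma sqint_mult_continuous:
  assumes "continuous_on {0..L} f" "sqint L g"
  shows "sqint L (\<lambda>x. f x * g x :: complex)"
  using continuous_bounded[OF assms(1)] sqint_mult_bounded[OF continuous_leb0_measurable[OF assms(1)] _ assms(2)] by metis

text \<open>From \<open>(a + b)^2 \<le> 2 a^2 + 2 b^2\<close> instead of Minkowski's inequality; the
  factors 2 are the reason why the density lemmas below ask for errors below
  \<open>e/4\<close>.\<close>

lemma integral_norm_diff_square_triangle:
  fixes f g h :: "real \<Rightarrow> 'a::euclidean_space"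
  assumes "sqint L (\<lambda>x. f x - g x)" "sqint L (\<lambda>x. g x - h x)"
  shows "(\<integral>x. (norm (f x - h x))\<^sup>2 \<partial>leb0 L) \<le> 2 * (\<integral>x. (norm (f x - g x))\<^sup>2 \<partial>leb0 L) + 2 * (\<integral>x. (norm (g x - h x))\<^sup>2 \<partial>leb0 L)"
proof -
  have i: "integrable (leb0 L) (\<lambda>x. (norm (f x - g x))\<^sup>2)" "integrable (leb0 L) (\<lambda>x. (norm (g x - h x))\<^sup>2)"
    using assms by (auto simp: sqint_def)
  have j: "integrable (leb0 L) (\<lambda>x. (norm (f x - h x))\<^sup>2)"
    using sqint_add[OF assms] by (simp add: sqint_def)
  have "(\<integral>x. (norm (f x - h x))\<^sup>2 \<partial>leb0 L) \<le> (\<integral>x. 2 * (norm (f x - g x))\<^sup>2 + 2 * (norm (g x - h x))\<^sup>2 \<partial>leb0 L)"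
  proof (rule Bochner_Integration.integral_mono)
    fix x
    have "(norm (f x - h x))\<^sup>2 \<le> (norm (f x - g x) + norm (g x - h x))\<^sup>2"
      using norm_triangle_ineq[of "f x - g x" "g x - h x"] by (intro power_mono) auto
    also have "\<dots> \<le> 2 * (norm (f x - g x))\<^sup>2 + 2 * (norm (g x - h x))\<^sup>2"
      using sum_squares_bound[of "norm (f x - g x)" "norm (g x - h x)"] by (simp add: power2_sum)
    finally show "(norm (f x - h x))\<^sup>2 \<le> 2 * (norm (f x - g x))\<^sup>2 + 2 * (norm (g x - h x))\<^sup>2" .
  qed (use i j in auto)
  also have "\<dots> = 2 * (\<integral>x. (norm (f x - g x))\<^sup>2 \<partial>leb0 L) + 2 * (\<integral>x. (norm (g x - h x))\<^sup>2 \<partial>leb0 L)"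
    using i by simp
  finally show ?thesis .
qed

section \<open>Dominated convergence and density of polynomials in L^2\<close>

lemma sqint_dominated_convergence:
  fixes f :: "real \<Rightarrow> 'a::euclidean_space"
  assumes f: "sqint L f" and s: "\<And>n. sqint L (s n)" and w: "integrable (leb0 L) w"
    and lim: "AE x in leb0 L. (\<lambda>n. s n x) \<longlonglongrightarrow> f x"
    and bound: "\<And>n x. x \<in> {0..L} \<Longrightarrow> (norm (f x - s n x))\<^sup>2 \<le> w x"
  shows "(\<lambda>n. \<integral>x. (norm (f x - s n x))\<^sup>2 \<partial>leb0 L) \<longlonglongrightarrow> 0"
proof -
  note [measurable] = sqint_measurable[OF f] sqint_measurable[OF s] borel_measurable_integrable[OF w]
  have "(\<lambda>n. \<integral>x. (norm (f x - s n x))\<^sup>2 \<partial>leb0 L) \<longlonglongrightarrow> (\<integral>x. 0 \<partial>leb0 L)"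
  proof (rule integral_dominated_convergence[where w = w])
    show "AE x in leb0 L. (\<lambda>n. (norm (f x - s n x))\<^sup>2) \<longlonglongrightarrow> 0"
      using lim
    proof eventually_elim
      case (elim x)
      have "(\<lambda>n. (norm (f x - s n x))\<^sup>2) \<longlonglongrightarrow> (norm (f x - f x))\<^sup>2"
        by (intro tendsto_intros elim)
      then show ?case by simp
    qed
    show "\<And>n. AE x in leb0 L. norm ((norm (f x - s n x))\<^sup>2) \<le> w x"
      using bound by (auto simp: space_restrict_space intro!: AE_I2)
  qed (use w in auto)
  then show ?thesis by simp
qed

text \<open>Truncation by projection onto a ball. The projection is nonexpansive and fixes 0, so it
  never increases the norm and \<open>4 |f|^2\<close> dominates the squared error; for each x the
  error is 0 as soon as the radius reaches \<open>|f x|\<close>.\<close>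

lemma L2_dense_bounded:
  fixes f :: "real \<Rightarrow> 'a::euclidean_space"
  assumes f: "sqint L f" and e: "e > 0"
  shows "\<exists>k>0. (\<integral>x. (norm (f x - closest_point (cball 0 k) (f x)))\<^sup>2 \<partial>leb0 L) < e"
proof -
  let ?c = "\<lambda>n. closest_point (cball 0 (real (Suc n))) :: 'a \<Rightarrow> 'a"
  have c0: "?c n 0 = 0" for n by (rule closest_point_self) simp
  have cn: "norm (?c n z) \<le> norm z" for n z
    using closest_point_lipschitz[of "cball (0::'a) (real (Suc n))" z 0] c0[of n] by simp
  have [measurable]: "?c n \<in> borel_measurable borel" for n
    by (intro borel_measurable_continuous_onI continuous_on_closest_point) auto
  note [measurable] = sqint_measurable[OF f]
  have "(\<lambda>n. \<integral>x. (norm (f x - ?c n (f x)))\<^sup>2 \<partial>leb0 L) \<longlonglongrightarrow> 0"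
  proof (rule sqint_dominated_convergence[OF f, where w = "\<lambda>x. 4 * (norm (f x))\<^sup>2"])
    show "sqint L (\<lambda>x. ?c n (f x))" for n
    proof (rule sqint_bound[OF _ f, where C = 1])
      show "(\<lambda>x. ?c n (f x)) \<in> borel_measurable (leb0 L)" by measurable
    qed (use cn in auto)
    show "integrable (leb0 L) (\<lambda>x. 4 * (norm (f x))\<^sup>2)" using f by (simp add: sqint_def)
    show "AE x in leb0 L. (\<lambda>n. ?c n (f x)) \<longlonglongrightarrow> f x"
    proof (rule AE_I2)
      fix x
      obtain N where N: "norm (f x) \<le> real N" using real_arch_simple by blast
      have "eventually (\<lambda>n. f x = ?c n (f x)) sequentially"
        using eventually_ge_at_top[of N]
        by eventually_elim (use N in \<open>auto intro!: closest_point_self[symmetric]\<close>)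
      then show "(\<lambda>n. ?c n (f x)) \<longlonglongrightarrow> f x"
        using tendsto_cong[of "\<lambda>_. f x"] tendsto_const by fast
    qed
    fix n x
    have "norm (f x - ?c n (f x)) \<le> 2 * norm (f x)"
      using norm_triangle_ineq4[of "f x" "?c n (f x)"] cn[of n "f x"] by simp
    then have "(norm (f x - ?c n (f x)))\<^sup>2 \<le> (2 * norm (f x))\<^sup>2" by (intro power_mono) auto
    then show "(norm (f x - ?c n (f x)))\<^sup>2 \<le> 4 * (norm (f x))\<^sup>2" by (simp add: power_mult_distrib)
  qed
  from order_tendstoD(2)[OF this e] obtain n where "(\<integral>x. (norm (f x - ?c n (f x)))\<^sup>2 \<partial>leb0 L) < e"
    by (auto simp: eventually_sequentially)
  then show ?thesis by (intro exI[of _ "real (Suc n)"]) simp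
qed

text \<open>Measurability gives continuous functions converging to f off a null set, but without a
  common bound. Truncating f first and projecting the continuous functions onto the same ball keeps
  them continuous and bounds the squared error by a constant, which is integrable on a finite
  measure.\<close>

lemma L2_dense_continuous:
  fixes f :: "real \<Rightarrow> 'a::euclidean_space"
  assumes f: "sqint L f" and e: "e > 0"
  shows "\<exists>g. continuous_on UNIV g \<and> (\<integral>x. (norm (f x - g x))\<^sup>2 \<partial>leb0 L) < e"
proof -
  obtain k where k: "k > 0" and fk: "(\<integral>x. (norm (f x - closest_point (cball 0 k) (f x)))\<^sup>2 \<partial>leb0 L) < e/4"
    using L2_dense_bounded[OF f, of "e/4"] e by auto
  let ?c = "closest_point (cball 0 k) :: 'a \<Rightarrow> 'a"
  have cc: "continuous_on UNIV ?c"
    by (rule continuous_on_closest_point) (use k in auto)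
  have cin: "?c z \<in> cball 0 k" for z
    by (rule closest_point_in_set) (use k in auto)
  then have cb: "norm (?c z) \<le> k" for z
    by (metis mem_cball_0)
  have [measurable]: "?c \<in> borel_measurable borel"
    by (intro borel_measurable_continuous_onI cc)
  note [measurable] = sqint_measurable[OF f]
  have cf: "sqint L (\<lambda>x. ?c (f x))"
    by (rule sqint_bounded[where C = k]) (use cb in auto)
  have "(\<lambda>x. indicat_real {0..L} x *\<^sub>R f x) \<in> borel_measurable lborel"
    using sqint_measurable[OF f] by (simp add: borel_measurable_restrict_space_iff)
  then have "(\<lambda>x. indicat_real {0..L} x *\<^sub>R f x) \<in> borel_measurable lebesgue"
    by (simp add: measurable_completion)
  then have "(\<lambda>x. indicat_real {0..L} x *\<^sub>R f x) measurable_on UNIV"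
    by (rule lebesgue_measurable_imp_measurable_on) simp
  then obtain N g where N: "negligible N" and g: "\<And>n. continuous_on UNIV (g n)"
    and lim: "\<And>x. x \<notin> N \<Longrightarrow> (\<lambda>n. g n x) \<longlonglongrightarrow> indicat_real {0..L} x *\<^sub>R f x"
    unfolding measurable_on_def by auto
  have gc: "continuous_on UNIV (\<lambda>x. ?c (g n x))" for n
    using continuous_on_compose[OF g[of n], of ?c] continuous_on_subset[OF cc] by (simp add: o_def)
  have "(\<lambda>n. \<integral>x. (norm (?c (f x) - ?c (g n x)))\<^sup>2 \<partial>leb0 L) \<longlonglongrightarrow> 0"
  proof (rule sqint_dominated_convergence[OF cf, where w = "\<lambda>x. (2*k)\<^sup>2"])
    show "sqint L (\<lambda>x. ?c (g n x))" for n
      by (rule continuous_sqint[OF continuous_on_subset[OF gc]]) simp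
    show "integrable (leb0 L) (\<lambda>x. (2*k)\<^sup>2)"
      by (rule sqint_integrable[OF sqint_const])
    have "AE x in lebesgue. x \<notin> N"
      using N by (simp add: negligible_iff_null_sets AE_not_in)
    then have "AE x in lborel. x \<notin> N" by (simp add: AE_completion_iff)
    then have "AE x in leb0 L. x \<notin> N" unfolding AE_leb0 by auto
    moreover have "AE x in leb0 L. x \<in> {0..L}" unfolding AE_leb0 by simp
    ultimately show "AE x in leb0 L. (\<lambda>n. ?c (g n x)) \<longlonglongrightarrow> ?c (f x)"
    proof eventually_elim
      case (elim x)
      then have "(\<lambda>n. g n x) \<longlonglongrightarrow> f x" using lim[of x] by simp
      then show ?case using continuous_on_tendsto_compose[OF cc] by simp
    qed
    fix n x
    have "norm (?c (f x) - ?c (g n x)) \<le> 2 * k"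
      using norm_triangle_ineq4[of "?c (f x)" "?c (g n x)"] cb[of "f x"] cb[of "g n x"] by simp
    then show "(norm (?c (f x) - ?c (g n x)))\<^sup>2 \<le> (2*k)\<^sup>2" by (intro power_mono) auto
  qed
  from order_tendstoD(2)[OF this, of "e/4"] e
  obtain n where n: "(\<integral>x. (norm (?c (f x) - ?c (g n x)))\<^sup>2 \<partial>leb0 L) < e/4"
    by (auto simp: eventually_sequentially)
  have "(\<integral>x. (norm (f x - ?c (g n x)))\<^sup>2 \<partial>leb0 L) \<le> 2 * (\<integral>x. (norm (f x - ?c (f x)))\<^sup>2 \<partial>leb0 L)
      + 2 * (\<integral>x. (norm (?c (f x) - ?c (g n x)))\<^sup>2 \<partial>leb0 L)"
    by (intro integral_norm_diff_square_triangle sqint_diff f cf continuous_sqint[OF continuous_on_subset[OF gc]]) simp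
  then show ?thesis using gc[of n] fk n by (intro exI[of _ "\<lambda>x. ?c (g n x)"]) auto
qed

lemma L2_dense_polynomial:
  fixes f :: "real \<Rightarrow> 'a::euclidean_space"
  assumes f: "sqint L f" and e: "e > 0"
  shows "\<exists>p. polynomial_function p \<and> (\<integral>x. (norm (f x - p x))\<^sup>2 \<partial>leb0 L) < e"
proof -
  obtain g where g: "continuous_on UNIV g" and fg: "(\<integral>x. (norm (f x - g x))\<^sup>2 \<partial>leb0 L) < e/4"
    using L2_dense_continuous[OF f, of "e/4"] e by auto
  have gL: "continuous_on {0..L} g" using g continuous_on_subset by blast
  interpret M: finite_measure "leb0 L" by (rule finite_measure_leb0)
  define M0 where "M0 = measure (leb0 L) (space (leb0 L))"
  \<comment> \<open>Uniform tolerance with \<open>d^2 * M0 < e/4\<close>; the \<open>+ 1\<close>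
    keeps the quotient meaningful when the interval has measure 0.\<close>
  define d where "d = sqrt (e / (4 * (M0 + 1)))"
  have m0: "M0 \<ge> 0" by (simp add: M0_def)
  have d: "d > 0" using e m0 by (simp add: d_def add_nonneg_pos)
  obtain p where p: "polynomial_function p" and gp: "\<And>x. x \<in> {0..L} \<Longrightarrow> norm (g x - p x) < d"
    using Stone_Weierstrass_polynomial_function[OF compact_Icc gL d] by auto
  have pL: "continuous_on {0..L} p" using continuous_on_polymonial_function[OF p] .
  have i: "integrable (leb0 L) (\<lambda>x. (norm (g x - p x))\<^sup>2)"
    using continuous_sqint[OF continuous_on_diff[OF gL pL]] by (simp add: sqint_def)
  have "(\<integral>x. (norm (g x - p x))\<^sup>2 \<partial>leb0 L) \<le> (\<integral>x. d\<^sup>2 \<partial>leb0 L)"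
  proof (rule Bochner_Integration.integral_mono[OF i])
    show "integrable (leb0 L) (\<lambda>x. d\<^sup>2)" by simp
    fix x assume "x \<in> space (leb0 L)"
    then have "norm (g x - p x) \<le> d" using gp[of x] by (simp add: space_restrict_space)
    then show "(norm (g x - p x))\<^sup>2 \<le> d\<^sup>2" by (intro power_mono) auto
  qed
  also have "\<dots> = d\<^sup>2 * M0" by (simp add: M0_def)
  also have "\<dots> = e/4 * (M0 / (M0 + 1))" using e m0 by (simp add: d_def)
  also have "\<dots> < e / 4 * 1"
    using e m0 by (intro mult_strict_left_mono) (auto simp: divide_less_eq)
  finally have "(\<integral>x. (norm (g x - p x))\<^sup>2 \<partial>leb0 L) < e/4" by simp
  moreover have "(\<integral>x. (norm (f x - p x))\<^sup>2 \<partial>leb0 L) \<le> 2 * (\<integral>x. (norm (f x - g x))\<^sup>2 \<partial>leb0 L)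
      + 2 * (\<integral>x. (norm (g x - p x))\<^sup>2 \<partial>leb0 L)"
    by (intro integral_norm_diff_square_triangle sqint_diff f continuous_sqint gL pL)
  ultimately show ?thesis using p fg by (intro exI[of _ p]) auto
qed

lemma sqint_Pair:
  assumes "sqint L f" "sqint L g"
  shows "sqint L (\<lambda>x. (f x, g x))"
  unfolding sqint_def
proof
  note [measurable] = assms[THEN sqint_measurable]
  show "(\<lambda>x. (f x, g x)) \<in> borel_measurable (leb0 L)" by (rule borel_measurable_Pair) measurable
  have "integrable (leb0 L) (\<lambda>x. (norm (f x))\<^sup>2 + (norm (g x))\<^sup>2)"
    using assms by (auto simp: sqint_def)
  then show "integrable (leb0 L) (\<lambda>x. (norm (f x, g x))\<^sup>2)" by (simp add: norm_Pair)
qed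

definition nsq :: "real \<Rightarrow> (real \<Rightarrow> 'a::euclidean_space) \<Rightarrow> real" where
  "nsq L f = (\<integral>x. (norm (f x))\<^sup>2 \<partial>leb0 L)"

lemma nsq_nonneg: "nsq L f \<ge> 0"
  by (simp add: nsq_def)

lemma l2norm_nsq: "(l2norm L f)\<^sup>2 = nsq L f"
  by (simp add: l2norm_def nsq_def integral_leb0)

lemma nsq_cong_AE:
  assumes "AE x in leb0 L. f x = g x" "sqint L f" "sqint L g"
  shows "nsq L f = nsq L g"
  unfolding nsq_def
proof (rule Bochner_Integration.integral_cong_AE)
  note [measurable] = assms(2,3)[THEN sqint_measurable]
  show "(\<lambda>x. (norm (f x))\<^sup>2) \<in> borel_measurable (leb0 L)" "(\<lambda>x. (norm (g x))\<^sup>2) \<in> borel_measurable (leb0 L)"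
    by measurable
qed (use assms(1) in auto)

lemma nsq_eq_0: "sqint L f \<Longrightarrow> nsq L f = 0 \<Longrightarrow> AE x in leb0 L. f x = 0"
  using integral_nonneg_eq_0_iff_AE[of "leb0 L" "\<lambda>x. (norm (f x))\<^sup>2"] by (simp add: nsq_def sqint_def)

lemma nsq_add:
  assumes "sqint L f" "sqint L g"
  shows "nsq L (\<lambda>x. f x + g x) \<le> 2 * nsq L f + 2 * nsq L g"
  using integral_norm_diff_square_triangle[of L f "\<lambda>_. 0" "\<lambda>x. - g x"] assms sqint_scaleR[OF assms(2), of "-1"] by (simp add: nsq_def)

lemma nsq_mult: "nsq L (\<lambda>x. complex_of_real c * f x) = c\<^sup>2 * nsq L f"
  by (simp add: nsq_def norm_mult power_mult_distrib)

section \<open>Weak derivatives\<close>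

lemma indicat_upto_swap: "indicat_real {..t} s = indicat_real {s..} t"
  by (simp add: indicator_def)

lemma indicat_from_measurable: "indicat_real {x..} \<in> borel_measurable (leb0 L)"
  by (rule measurable_restrict_space1) simp

lemma indicat_upto_measurable: "indicat_real {..x} \<in> borel_measurable (leb0 L)"
  by (rule measurable_restrict_space1) simp

text \<open>The square is the union of the triangles t \<le> s and s \<le> t. After Fubini's theorem
  swaps the order in the second integral, both terms integrate \<open>a s * b t\<close>, one over
  each triangle. This is the product rule in integrated form.\<close>

lemma double_triangle:
  fixes a b :: cfun
  assumes "integrable (leb0 L) a" "integrable (leb0 L) b"
  shows "(\<integral>s. (\<integral>t. indicat_real {..s} t *\<^sub>R (a s * b t) \<partial>leb0 L) \<partial>leb0 L)
     + (\<integral>s. (\<integral>t. indicat_real {..s} t *\<^sub>R (a t * b s) \<partial>leb0 L) \<partial>leb0 L)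
     = (\<integral>s. a s \<partial>leb0 L) * (\<integral>s. b s \<partial>leb0 L)"
proof -
  interpret M: finite_measure "leb0 L" by (rule finite_measure_leb0)
  interpret P: pair_sigma_finite "leb0 L" "leb0 L" by unfold_locales
  note [measurable] = borel_measurable_integrable[OF assms(1)] borel_measurable_integrable[OF assms(2)]
  have ab: "integrable (leb0 L \<Otimes>\<^sub>M leb0 L) (\<lambda>(s,t). a s * b t)"
    by (rule P.Fubini_integrable) (use assms in \<open>auto simp: norm_mult\<close>)
  have [measurable]: "(\<lambda>x. x) \<in> borel_measurable (leb0 L)"
    by (rule measurable_restrict_space1) simp
  have meas1: "(\<lambda>(s,t). indicat_real {..s} t) \<in> borel_measurable (leb0 L \<Otimes>\<^sub>M leb0 L)"
  proof -
    have eq: "(\<lambda>(s,t). indicat_real {..s} t) = (\<lambda>p. if snd p \<le> fst p then 1 else 0)"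
      by (auto simp: fun_eq_iff)
    show ?thesis unfolding eq
      by measurable
  qed
  note [measurable] = meas1
  have meas2 [measurable]: "(\<lambda>(s,t). indicat_real {..t} s) \<in> borel_measurable (leb0 L \<Otimes>\<^sub>M leb0 L)"
    using measurable_compose[OF measurable_pair_swap' meas1] by (simp add: case_prod_beta)
  have i1: "integrable (leb0 L \<Otimes>\<^sub>M leb0 L) (\<lambda>(s,t). indicat_real {..s} t *\<^sub>R (a s * b t))"
    by (rule Bochner_Integration.integrable_bound[OF ab]) (auto simp: indicator_def norm_mult)
  have i2: "integrable (leb0 L \<Otimes>\<^sub>M leb0 L) (\<lambda>(s,t). indicat_real {..t} s *\<^sub>R (a s * b t))"
    by (rule Bochner_Integration.integrable_bound[OF ab]) (auto simp: indicator_def norm_mult)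
  have "(\<integral>s. (\<integral>t. indicat_real {..s} t *\<^sub>R (a t * b s) \<partial>leb0 L) \<partial>leb0 L)
      = (\<integral>t. (\<integral>s. indicat_real {..s} t *\<^sub>R (a t * b s) \<partial>leb0 L) \<partial>leb0 L)"
    by (rule P.Fubini_integral[OF i2])
  moreover have "(\<integral>s. (\<integral>t. indicat_real {..s} t *\<^sub>R (a s * b t) \<partial>leb0 L) \<partial>leb0 L)
      + (\<integral>s. (\<integral>t. indicat_real {..t} s *\<^sub>R (a s * b t) \<partial>leb0 L) \<partial>leb0 L)
      = (\<integral>s. (\<integral>t. indicat_real {..s} t *\<^sub>R (a s * b t) \<partial>leb0 L)
         + (\<integral>t. indicat_real {..t} s *\<^sub>R (a s * b t) \<partial>leb0 L) \<partial>leb0 L)"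
    by (rule Bochner_Integration.integral_add[symmetric]) (use P.integrable_fst[OF i1] P.integrable_fst[OF i2] in auto)
  moreover have "\<dots> = (\<integral>s. a s * (\<integral>t. b t \<partial>leb0 L) \<partial>leb0 L)"
  proof (rule Bochner_Integration.integral_cong_AE)
    show "AE s in leb0 L. (\<integral>t. indicat_real {..s} t *\<^sub>R (a s * b t) \<partial>leb0 L)
         + (\<integral>t. indicat_real {..t} s *\<^sub>R (a s * b t) \<partial>leb0 L) = a s * (\<integral>t. b t \<partial>leb0 L)"
    proof (rule AE_I2)
      fix s
      have "integrable (leb0 L) (\<lambda>t. indicat_real {..s} t *\<^sub>R (a s * b t))"
        by (rule Bochner_Integration.integrable_bound[OF integrable_mult_right[OF assms(2), of "a s"]])
           (auto simp: indicator_def norm_mult)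
      moreover have "integrable (leb0 L) (\<lambda>t. indicat_real {..t} s *\<^sub>R (a s * b t))"
      proof (rule Bochner_Integration.integrable_bound[OF integrable_mult_right[OF assms(2), of "a s"]])
        note [measurable] = indicat_upto_measurable indicat_from_measurable
        show "(\<lambda>t. indicat_real {..t} s *\<^sub>R (a s * b t)) \<in> borel_measurable (leb0 L)" unfolding indicat_upto_swap[of _ s] by measurable
      qed (auto simp: indicator_def norm_mult)
      ultimately have "(\<integral>t. indicat_real {..s} t *\<^sub>R (a s * b t) \<partial>leb0 L)
         + (\<integral>t. indicat_real {..t} s *\<^sub>R (a s * b t) \<partial>leb0 L)
         = (\<integral>t. indicat_real {..s} t *\<^sub>R (a s * b t) + indicat_real {..t} s *\<^sub>R (a s * b t) \<partial>leb0 L)"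
        by (rule Bochner_Integration.integral_add[symmetric])
      also have "\<dots> = (\<integral>t. a s * b t \<partial>leb0 L)"
      proof (rule Bochner_Integration.integral_cong_AE)
        note [measurable] = indicat_upto_measurable indicat_from_measurable
        show "(\<lambda>t. indicat_real {..s} t *\<^sub>R (a s * b t) + indicat_real {..t} s *\<^sub>R (a s * b t)) \<in> borel_measurable (leb0 L)"
          unfolding indicat_upto_swap[of _ s] by measurable
        \<comment> \<open>At t = s both indicators are 1 and the product is counted twice, so the
          identity holds only off this point.\<close>
        have "AE t in lborel. t \<noteq> s" by (rule AE_lborel_singleton)
        then have "AE t in leb0 L. t \<noteq> s" unfolding AE_leb0 by auto
        then show "AE t in leb0 L. indicat_real {..s} t *\<^sub>R (a s * b t) + indicat_real {..t} s *\<^sub>R (a s * b t) = a s * b t"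
          by eventually_elim (auto simp: indicator_def)
      qed simp
      also have "\<dots> = a s * (\<integral>t. b t \<partial>leb0 L)" by simp
      finally show "(\<integral>t. indicat_real {..s} t *\<^sub>R (a s * b t) \<partial>leb0 L)
         + (\<integral>t. indicat_real {..t} s *\<^sub>R (a s * b t) \<partial>leb0 L) = a s * (\<integral>t. b t \<partial>leb0 L)" .
    qed
    show "(\<lambda>s. (\<integral>t. indicat_real {..s} t *\<^sub>R (a s * b t) \<partial>leb0 L)
         + (\<integral>t. indicat_real {..t} s *\<^sub>R (a s * b t) \<partial>leb0 L)) \<in> borel_measurable (leb0 L)"
      by (intro borel_measurable_integrable Bochner_Integration.integrable_add P.integrable_fst i1 i2)
  qed simp
  ultimately show ?thesis by simp
qed

lemma wderiv_sqint: "is_wderiv L f g \<Longrightarrow> sqint L g"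
  by (simp add: is_wderiv_def L2_sqint)

lemma wderiv_eq:
  assumes "is_wderiv L f g" "x \<in> {0..L}"
  shows "f x = f 0 + (\<integral>t. indicat_real {..x} t *\<^sub>R g t \<partial>leb0 L)"
  using assms integral_leb0_upto[of x L g] unfolding is_wderiv_def by metis

lemma wderivI:
  assumes "sqint L g" "\<And>x. x \<in> {0..L} \<Longrightarrow> f x = f 0 + (\<integral>t. indicat_real {..x} t *\<^sub>R g t \<partial>leb0 L)"
  shows "is_wderiv L f g"
  using assms integral_leb0_upto[of _ L g] unfolding is_wderiv_def L2_sqint by metis

lemma integrable_upto:
  fixes g :: "real \<Rightarrow> 'a::euclidean_space"
  assumes "integrable (leb0 L) g"
  shows "integrable (leb0 L) (\<lambda>t. indicat_real {..x} t *\<^sub>R g t)"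
proof (rule Bochner_Integration.integrable_bound[OF assms])
  note [measurable] = borel_measurable_integrable[OF assms] indicat_upto_measurable
  show "(\<lambda>t. indicat_real {..x} t *\<^sub>R g t) \<in> borel_measurable (leb0 L)" by measurable
qed (auto simp: indicator_def)

lemma wderiv_add:
  assumes "is_wderiv L f f'" "is_wderiv L g g'"
  shows "is_wderiv L (\<lambda>x. f x + g x) (\<lambda>x. f' x + g' x)"
proof (rule wderivI)
  show "sqint L (\<lambda>x. f' x + g' x)" by (rule sqint_add[OF assms[THEN wderiv_sqint]])
  fix x assume x: "x \<in> {0..L}"
  show "f x + g x = f 0 + g 0 + (\<integral>t. indicat_real {..x} t *\<^sub>R (f' t + g' t) \<partial>leb0 L)"
    unfolding wderiv_eq[OF assms(1) x] wderiv_eq[OF assms(2) x] scaleR_add_right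
    unfolding Bochner_Integration.integral_add[OF assms[THEN wderiv_sqint, THEN sqint_integrable, THEN integrable_upto]]
    by (simp only: add_ac)
qed

lemma wderiv_linear:
  assumes "is_wderiv L f f'" "bounded_linear h"
  shows "is_wderiv L (\<lambda>x. h (f x)) (\<lambda>x. h (f' x))"
proof (rule wderivI)
  show "sqint L (\<lambda>x. h (f' x))" by (rule sqint_bounded_linear[OF assms(2) wderiv_sqint[OF assms(1)]])
  fix x assume x: "x \<in> {0..L}"
  have "h (f x) = h (f 0) + h (\<integral>t. indicat_real {..x} t *\<^sub>R f' t \<partial>leb0 L)"
    unfolding wderiv_eq[OF assms(1) x] by (rule linear_add[OF bounded_linear.linear[OF assms(2)]])
  also have "h (\<integral>t. indicat_real {..x} t *\<^sub>R f' t \<partial>leb0 L) = (\<integral>t. h (indicat_real {..x} t *\<^sub>R f' t) \<partial>leb0 L)"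
    by (rule integral_bounded_linear[OF assms(2), symmetric])
       (rule assms(1)[THEN wderiv_sqint, THEN sqint_integrable, THEN integrable_upto])
  finally show "h (f x) = h (f 0) + (\<integral>t. indicat_real {..x} t *\<^sub>R h (f' t) \<partial>leb0 L)"
    using bounded_linear.linear[OF assms(2)] by (simp add: linear_cmul)
qed

lemma wderiv_cmult: "is_wderiv L f f' \<Longrightarrow> is_wderiv L (\<lambda>x. c * f x) (\<lambda>x. c * f' x)"
  by (rule wderiv_linear[OF _ bounded_linear_mult_right])

lemma wderiv_cnj: "is_wderiv L f f' \<Longrightarrow> is_wderiv L (\<lambda>x. cnj (f x)) (\<lambda>x. cnj (f' x))"
  by (rule wderiv_linear[OF _ bounded_linear_cnj])

lemma wderiv_diff:
  assumes "is_wderiv L f f'" "is_wderiv L g g'"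
  shows "is_wderiv L (\<lambda>x. f x - g x) (\<lambda>x. f' x - g' x)"
  using wderiv_add[OF assms(1) wderiv_cmult[OF assms(2), of "-1"]] by simp

lemma wderiv_continuous:
  assumes "is_wderiv L f f'"
  shows "continuous_on {0..L} f"
proof -
  have i: "set_integrable lborel {0..L} f'"
    using sqint_integrable[OF wderiv_sqint[OF assms]] unfolding integrable_leb0 .
  have i': "set_integrable lborel {0..x} f'" if "x \<in> {0..L}" for x
    by (rule set_integrable_subset[OF i]) (use that in auto)
  have "continuous_on {0..L} (\<lambda>x. f 0 + integral {0..x} f')"
    by (intro continuous_intros indefinite_integral_continuous_1 set_borel_integral_eq_integral(1)[OF i])
  then show ?thesis
  proof (rule continuous_on_eq)
    fix x assume "x \<in> {0..L}"
    then show "f 0 + integral {0..x} f' = f x"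
      using assms set_borel_integral_eq_integral(2)[OF i'] unfolding is_wderiv_def by metis
  qed
qed

text \<open>Both factors are an initial value plus an integral. Expanding the product leaves a
  product of two integrals, which \<open>double_triangle\<close> splits into what remains of the
  integrals of \<open>f' g\<close> and \<open>f g'\<close> after the initial values are
  subtracted.\<close>

lemma wderiv_mult:
  assumes f: "is_wderiv L f f'" and g: "is_wderiv L g g'"
  shows "is_wderiv L (\<lambda>x. f x * g x) (\<lambda>x. f' x * g x + f x * g' x)"
proof (rule wderivI)
  note cont = assms[THEN wderiv_continuous]
  note sq = assms[THEN wderiv_sqint]
  show "sqint L (\<lambda>x. f' x * g x + f x * g' x)"
    using sqint_add[OF sqint_mult_continuous[OF cont(2) sq(1)] sqint_mult_continuous[OF cont(1) sq(2)]]
    by (simp add: mult.commute)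
  have i1: "integrable (leb0 L) (\<lambda>x. f' x * g x)" and i2: "integrable (leb0 L) (\<lambda>x. f x * g' x)"
    using sqint_mult_continuous[OF cont(2) sq(1)] sqint_mult_continuous[OF cont(1) sq(2)]
    by (simp_all add: sqint_integrable mult.commute)
  fix x assume x: "x \<in> {0..L}"
  \<comment> \<open>Cutting the derivatives off at x turns the claim at x into an identity over the
    whole interval: for s \<le> x the cut leaves \<open>f s\<close> and \<open>g s\<close>
    unchanged, and for s > x all terms vanish.\<close>
  let ?a = "\<lambda>t. indicat_real {..x} t *\<^sub>R f' t" and ?b = "\<lambda>t. indicat_real {..x} t *\<^sub>R g' t"
  note ia = integrable_upto[OF sqint_integrable[OF sq(1)], of x] and ib = integrable_upto[OF sqint_integrable[OF sq(2)], of x]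
  have fe: "f s = f 0 + (\<integral>t. indicat_real {..s} t *\<^sub>R ?a t \<partial>leb0 L)"
    and ge: "g s = g 0 + (\<integral>t. indicat_real {..s} t *\<^sub>R ?b t \<partial>leb0 L)"
    if "s \<in> {0..x}" for s
  proof -
    have s: "s \<in> {0..L}" using that x by auto
    have *: "indicat_real {..s} t *\<^sub>R indicat_real {..x} t *\<^sub>R y = indicat_real {..s} t *\<^sub>R y" for t and y::complex
      using that by (auto simp: indicator_def)
    show "f s = f 0 + (\<integral>t. indicat_real {..s} t *\<^sub>R ?a t \<partial>leb0 L)"
         "g s = g 0 + (\<integral>t. indicat_real {..s} t *\<^sub>R ?b t \<partial>leb0 L)"
      unfolding * by (rule wderiv_eq[OF f s], rule wderiv_eq[OF g s])
  qed
  have pa: "indicat_real {..x} s *\<^sub>R (f' s * g s) - g 0 * ?a s = (\<integral>t. indicat_real {..s} t *\<^sub>R (?a s * ?b t) \<partial>leb0 L)"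
    and pb: "indicat_real {..x} s *\<^sub>R (f s * g' s) - f 0 * ?b s = (\<integral>t. indicat_real {..s} t *\<^sub>R (?a t * ?b s) \<partial>leb0 L)"
    if "s \<in> space (leb0 L)" for s
  proof -
    have s0: "s \<in> {0..L}" using that by (simp add: space_restrict_space)
    have "(\<integral>t. indicat_real {..s} t *\<^sub>R (?a s * ?b t) \<partial>leb0 L) = (\<integral>t. ?a s * (indicat_real {..s} t *\<^sub>R ?b t) \<partial>leb0 L)"
      by (simp add: mult_ac)
    also have "\<dots> = ?a s * (\<integral>t. indicat_real {..s} t *\<^sub>R ?b t \<partial>leb0 L)"
      by (rule integral_mult_right_zero)
    also have "\<dots> = indicat_real {..x} s *\<^sub>R (f' s * g s) - g 0 * ?a s"
    proof (cases "s \<le> x")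
      case True
      then have "(\<integral>t. indicat_real {..s} t *\<^sub>R ?b t \<partial>leb0 L) = g s - g 0" using ge[of s] s0 by simp
      then show ?thesis using True by (simp only:) (simp add: algebra_simps)
    qed simp
    finally show "indicat_real {..x} s *\<^sub>R (f' s * g s) - g 0 * ?a s = (\<integral>t. indicat_real {..s} t *\<^sub>R (?a s * ?b t) \<partial>leb0 L)" ..
    have "(\<integral>t. indicat_real {..s} t *\<^sub>R (?a t * ?b s) \<partial>leb0 L) = (\<integral>t. (indicat_real {..s} t *\<^sub>R ?a t) * ?b s \<partial>leb0 L)"
      by (simp add: mult_ac)
    also have "\<dots> = (\<integral>t. indicat_real {..s} t *\<^sub>R ?a t \<partial>leb0 L) * ?b s"
      by (rule integral_mult_left_zero)
    also have "\<dots> = indicat_real {..x} s *\<^sub>R (f s * g' s) - f 0 * ?b s"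
    proof (cases "s \<le> x")
      case True
      then have "(\<integral>t. indicat_real {..s} t *\<^sub>R ?a t \<partial>leb0 L) = f s - f 0" using fe[of s] s0 by simp
      then show ?thesis using True by (simp only:) (simp add: algebra_simps)
    qed simp
    finally show "indicat_real {..x} s *\<^sub>R (f s * g' s) - f 0 * ?b s = (\<integral>t. indicat_real {..s} t *\<^sub>R (?a t * ?b s) \<partial>leb0 L)" ..
  qed
  have I: "integrable (leb0 L) (\<lambda>s. indicat_real {..x} s *\<^sub>R (f' s * g s))"
    "integrable (leb0 L) (\<lambda>s. indicat_real {..x} s *\<^sub>R (f s * g' s))"
    by (rule integrable_upto[OF i1], rule integrable_upto[OF i2])
  have "(\<integral>s. indicat_real {..x} s *\<^sub>R (f' s * g s) \<partial>leb0 L) - g 0 * (\<integral>s. ?a s \<partial>leb0 L)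
      = (\<integral>s. indicat_real {..x} s *\<^sub>R (f' s * g s) - g 0 * ?a s \<partial>leb0 L)"
    unfolding Bochner_Integration.integral_diff[OF I(1) integrable_mult_right[OF ia]] integral_mult_right_zero ..
  also have "\<dots> = (\<integral>s. (\<integral>t. indicat_real {..s} t *\<^sub>R (?a s * ?b t) \<partial>leb0 L) \<partial>leb0 L)"
    by (rule Bochner_Integration.integral_cong[OF refl pa])
  finally have A: "(\<integral>s. indicat_real {..x} s *\<^sub>R (f' s * g s) \<partial>leb0 L) - g 0 * (\<integral>s. ?a s \<partial>leb0 L)
      = (\<integral>s. (\<integral>t. indicat_real {..s} t *\<^sub>R (?a s * ?b t) \<partial>leb0 L) \<partial>leb0 L)" .
  have "(\<integral>s. indicat_real {..x} s *\<^sub>R (f s * g' s) \<partial>leb0 L) - f 0 * (\<integral>s. ?b s \<partial>leb0 L)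
      = (\<integral>s. indicat_real {..x} s *\<^sub>R (f s * g' s) - f 0 * ?b s \<partial>leb0 L)"
    unfolding Bochner_Integration.integral_diff[OF I(2) integrable_mult_right[OF ib]] integral_mult_right_zero ..
  also have "\<dots> = (\<integral>s. (\<integral>t. indicat_real {..s} t *\<^sub>R (?a t * ?b s) \<partial>leb0 L) \<partial>leb0 L)"
    by (rule Bochner_Integration.integral_cong[OF refl pb])
  finally have B: "(\<integral>s. indicat_real {..x} s *\<^sub>R (f s * g' s) \<partial>leb0 L) - f 0 * (\<integral>s. ?b s \<partial>leb0 L)
      = (\<integral>s. (\<integral>t. indicat_real {..s} t *\<^sub>R (?a t * ?b s) \<partial>leb0 L) \<partial>leb0 L)" .
  have C: "(\<integral>t. indicat_real {..x} t *\<^sub>R (f' t * g t + f t * g' t) \<partial>leb0 L)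
     = (\<integral>s. indicat_real {..x} s *\<^sub>R (f' s * g s) \<partial>leb0 L) + (\<integral>s. indicat_real {..x} s *\<^sub>R (f s * g' s) \<partial>leb0 L)"
    unfolding scaleR_add_right by (rule Bochner_Integration.integral_add[OF I])
  \<comment> \<open>\<open>p\<close>, \<open>q\<close> stand for the initial values,
    \<open>a\<close>, \<open>b\<close> for the increments up to x, and \<open>X\<close>,
    \<open>Y\<close> for the integrals of \<open>f' g\<close> and \<open>f g'\<close>.\<close>
  have alg: "(p + a) * (q + b) = p * q + (X + Y)" if "X - q * a + (Y - p * b) = a * b" for p q a b X Y :: complex
  proof -
    have "(p + a) * (q + b) = p * q + q * a + p * b + a * b" by (simp add: algebra_simps)
    then show ?thesis unfolding that[symmetric] by simp
  qed
  show "f x * g x = f 0 * g 0 + (\<integral>t. indicat_real {..x} t *\<^sub>R (f' t * g t + f t * g' t) \<partial>leb0 L)"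
    unfolding wderiv_eq[OF f x] wderiv_eq[OF g x] C
    by (rule alg) (unfold A B, rule double_triangle[OF ia ib])
qed

lemma wderiv_C1:
  assumes "\<And>x. x \<in> {0..L} \<Longrightarrow> (f has_vector_derivative f' x) (at x within {0..L})" "continuous_on {0..L} f'"
  shows "is_wderiv L f f'"
  unfolding is_wderiv_def
proof (intro conjI ballI)
  show "L2 L f'" using continuous_sqint[OF assms(2)] by (simp add: L2_sqint)
  fix x assume x: "x \<in> {0..L}"
  have "(LINT t:{0..x}|lborel. f' t) = f x - f 0"
    unfolding set_lebesgue_integral_def
  proof (rule integral_FTC_atLeastAtMost)
    show "continuous_on {0..x} f'" using assms(2) by (rule continuous_on_subset) (use x in auto)
    show "(f has_vector_derivative f' y) (at y within {0..x})" if "0 \<le> y" "y \<le> x" for y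
      using assms(1)[of y] that x by (auto intro: has_vector_derivative_within_subset)
  qed (use x in auto)
  then show "f x = f 0 + (LINT t:{0..x}|lborel. f' t)" by simp
qed

lemma wderiv_polynomial:
  assumes "polynomial_function p"
  obtains p' where "polynomial_function p'" "is_wderiv L p p'"
proof -
  obtain p' where p': "polynomial_function p'" "\<And>x. (p has_vector_derivative (p' x)) (at x)"
    using has_vector_derivative_polynomial_function[OF assms] by blast
  have "is_wderiv L p p'"
    by (rule wderiv_C1)
       (use p' continuous_on_polymonial_function in \<open>auto intro: has_vector_derivative_at_within\<close>)
  then show ?thesis using p' that by blast
qed

text \<open>A lemma of du Bois-Reymond type. Since f vanishes, the product rule with a polynomial p
  says that \<open>k p\<close> has integral 0; taking p close to \<open>cnj k\<close> in L^2 and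
  expanding \<open>|cnj k - p|^2\<close> bounds the integral of \<open>|k|^2\<close> by the squared
  approximation error.\<close>

lemma wderiv_zero:
  assumes L: "L \<ge> 0" and f: "is_wderiv L f k" "\<And>x. x \<in> {0..L} \<Longrightarrow> f x = 0"
  shows "AE x in leb0 L. k x = 0"
proof -
  have k: "sqint L k" using f(1) by (rule wderiv_sqint)
  have ck: "sqint L (\<lambda>x. cnj (k x))" by (rule sqint_bounded_linear[OF bounded_linear_cnj k])
  have ik: "integrable (leb0 L) (\<lambda>x. (norm (k x))\<^sup>2)" using k by (simp add: sqint_def)
  let ?I = "\<integral>x. (norm (k x))\<^sup>2 \<partial>leb0 L"
  have "?I \<le> 0 + e" if e: "e > 0" for e
  proof -
    obtain p where p: "polynomial_function p" and ap: "(\<integral>x. (norm (cnj (k x) - p x))\<^sup>2 \<partial>leb0 L) < e"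
      using L2_dense_polynomial[OF ck e] by blast
    obtain p' where p': "is_wderiv L p p'" using wderiv_polynomial[OF p] by blast
    have pc: "continuous_on {0..L} p" by (rule wderiv_continuous[OF p'])
    note pm = continuous_leb0_measurable[OF pc]
    have kp: "integrable (leb0 L) (\<lambda>x. k x * p x)"
      using sqint_integrable[OF sqint_mult_continuous[OF pc k]] by (simp add: mult.commute)
    have dp: "integrable (leb0 L) (\<lambda>x. (norm (cnj (k x) - p x))\<^sup>2)"
      using sqint_diff[OF ck continuous_sqint[OF pc]] by (simp add: sqint_def)
    have w: "is_wderiv L (\<lambda>x. f x * p x) (\<lambda>x. k x * p x + f x * p' x)"
      by (rule wderiv_mult[OF f(1) p'])
    have "f L * p L = f 0 * p 0 + (\<integral>x. indicat_real {..L} x *\<^sub>R (k x * p x + f x * p' x) \<partial>leb0 L)"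
      using wderiv_eq[OF w, of L] L by simp
    also have "(\<integral>x. indicat_real {..L} x *\<^sub>R (k x * p x + f x * p' x) \<partial>leb0 L) = (\<integral>x. k x * p x \<partial>leb0 L)"
      by (rule Bochner_Integration.integral_cong) (use f(2) in \<open>auto simp: space_restrict_space\<close>)
    finally have z: "(\<integral>x. k x * p x \<partial>leb0 L) = 0" using f(2) L by simp
    have "?I \<le> (\<integral>x. 2 * Re (k x * p x) + (norm (cnj (k x) - p x))\<^sup>2 \<partial>leb0 L)"
    proof (rule Bochner_Integration.integral_mono[OF ik])
      show "integrable (leb0 L) (\<lambda>x. 2 * Re (k x * p x) + (norm (cnj (k x) - p x))\<^sup>2)"
        using kp dp by (intro Bochner_Integration.integrable_add integrable_mult_right integrable_Re)
      fix x
      have "(norm (cnj (k x) - p x))\<^sup>2 = (norm (k x))\<^sup>2 - 2 * Re (k x * p x) + (norm (p x))\<^sup>2"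
        unfolding cmod_power2 by (simp add: power2_eq_square algebra_simps)
      then show "(norm (k x))\<^sup>2 \<le> 2 * Re (k x * p x) + (norm (cnj (k x) - p x))\<^sup>2" by simp
    qed
    also have "\<dots> = 2 * Re (\<integral>x. k x * p x \<partial>leb0 L) + (\<integral>x. (norm (cnj (k x) - p x))\<^sup>2 \<partial>leb0 L)"
      using kp dp integral_Re[OF kp] by (subst Bochner_Integration.integral_add) (auto intro!: integrable_Re integrable_mult_right simp del: times_complex.simps)
    finally show ?thesis using z ap by simp
  qed
  then have "?I \<le> 0" by (rule field_le_epsilon)
  moreover have "?I \<ge> 0" by simp
  ultimately have "?I = 0" by simp
  then have "AE x in leb0 L. (norm (k x))\<^sup>2 = 0"
    using integral_nonneg_eq_0_iff_AE[OF ik] by simp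
  then show ?thesis by simp
qed

text \<open>This makes the arbitrary choice in \<open>wd\<close> harmless up to null sets.\<close>

lemma wderiv_unique:
  assumes "L \<ge> 0" "is_wderiv L f g" "is_wderiv L f h"
  shows "AE x in leb0 L. g x = h x"
  using wderiv_zero[OF assms(1) wderiv_diff[OF assms(2,3)]] by simp

text \<open>L^2 does not see endpoint values: powers of \<open>1 - x/L\<close> and
  \<open>x/L\<close> are 1 at one end and tend to 0 almost everywhere, so adding multiples of them
  to an approximating polynomial corrects both values at vanishing cost. This freedom later lets an
  approximating state satisfy the boundary conditions.\<close>

lemma H1_dense:
  assumes L: "L > 0" and f: "sqint L f" and e: "e > 0"
  shows "\<exists>q q'. is_wderiv L q q' \<and> q 0 = a \<and> q L = b \<and> (\<integral>x. (norm (f x - q x))\<^sup>2 \<partial>leb0 L) < e"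
proof -
  obtain p where p: "polynomial_function p" and fp: "(\<integral>x. (norm (f x - p x))\<^sup>2 \<partial>leb0 L) < e/4"
    using L2_dense_polynomial[OF f, of "e/4"] e by auto
  have pL: "continuous_on {0..L} p" using continuous_on_polymonial_function[OF p] .
  \<comment> \<open>The exponent \<open>Suc n\<close> is never 0, so each corrector vanishes at the
    opposite endpoint.\<close>
  let ?s = "\<lambda>n x. (a - p 0) * complex_of_real ((1 - x/L)^Suc n) + (b - p L) * complex_of_real ((x/L)^Suc n)"
  let ?q = "\<lambda>n x. p x + ?s n x"
  let ?C = "cmod (a - p 0) + cmod (b - p L)"
  have sc: "continuous_on {0..L} (?s n)" for n
    using L by (intro continuous_intros) auto
  have "(\<lambda>n. \<integral>x. (norm (0 - ?s n x))\<^sup>2 \<partial>leb0 L) \<longlonglongrightarrow> 0"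
  proof (rule sqint_dominated_convergence[where w = "\<lambda>x. ?C\<^sup>2"])
    show "sqint L (\<lambda>x. 0)" "integrable (leb0 L) (\<lambda>x. ?C\<^sup>2)"
      by (rule sqint_const, rule sqint_integrable[OF sqint_const])
    show "sqint L (?s n)" for n by (rule continuous_sqint[OF sc])
    have "AE x in lborel. x \<noteq> 0 \<and> x \<noteq> L"
      by (intro AE_conjI AE_lborel_singleton)
    then have "AE x in leb0 L. x \<noteq> 0 \<and> x \<noteq> L" unfolding AE_leb0 by auto
    moreover have "AE x in leb0 L. x \<in> {0..L}" unfolding AE_leb0 by simp
    ultimately show "AE x in leb0 L. (\<lambda>n. ?s n x) \<longlonglongrightarrow> 0"
    proof eventually_elim
      case (elim x)
      have lim0: "(\<lambda>n. (1 - x/L)^n) \<longlonglongrightarrow> 0" "(\<lambda>n. (x/L)^n) \<longlonglongrightarrow> 0"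
        using elim L by (auto intro!: LIMSEQ_realpow_zero)
      have "(\<lambda>n. ?s n x) \<longlonglongrightarrow> (a - p 0) * complex_of_real 0 + (b - p L) * complex_of_real 0"
        by (intro tendsto_add tendsto_mult tendsto_const tendsto_of_real lim0[THEN LIMSEQ_Suc])
      then show ?case by simp
    qed
    fix n x assume x: "x \<in> {0..L}"
    have "cmod (0 - ?s n x) \<le> cmod ((a - p 0) * complex_of_real ((1 - x/L)^Suc n)) + cmod ((b - p L) * complex_of_real ((x/L)^Suc n))"
      using norm_triangle_ineq[of "(a - p 0) * complex_of_real ((1 - x/L)^Suc n)" "(b - p L) * complex_of_real ((x/L)^Suc n)"]
      by (simp only: norm_minus_cancel diff_0)
    also have "\<dots> = cmod (a - p 0) * (1 - x/L)^Suc n + cmod (b - p L) * (x/L)^Suc n"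
      using x L by (simp only: norm_mult norm_of_real) (auto simp: abs_mult)
    also have "\<dots> \<le> cmod (a - p 0) * 1 + cmod (b - p L) * 1"
      using x L by (intro add_mono mult_left_mono power_le_one) auto
    finally show "(norm (0 - ?s n x))\<^sup>2 \<le> ?C\<^sup>2" by (intro power_mono) auto
  qed
  from order_tendstoD(2)[OF this, of "e/4"] e
  obtain n where n: "(\<integral>x. (norm (0 - ?s n x))\<^sup>2 \<partial>leb0 L) < e/4"
    by (auto simp: eventually_sequentially)
  have "(\<integral>x. (norm (f x - ?q n x))\<^sup>2 \<partial>leb0 L) \<le> 2 * (\<integral>x. (norm (f x - p x))\<^sup>2 \<partial>leb0 L)
      + 2 * (\<integral>x. (norm (p x - ?q n x))\<^sup>2 \<partial>leb0 L)"
    by (intro integral_norm_diff_square_triangle sqint_diff f continuous_sqint pL continuous_on_add sc)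
  also have "(\<lambda>x. (norm (p x - ?q n x))\<^sup>2) = (\<lambda>x. (norm (0 - ?s n x))\<^sup>2)" by simp
  finally have "(\<integral>x. (norm (f x - ?q n x))\<^sup>2 \<partial>leb0 L) < e" using n fp by simp
  moreover have "?q n 0 = a" "?q n L = b" using L by auto
  moreover have "polynomial_function (?q n)"
  proof -
    have r: "polynomial_function (\<lambda>x. c * complex_of_real (h x))" if "real_polynomial_function h" for h and c :: complex
      using polynomial_function_mult[OF that[unfolded real_polynomial_function_eq] polynomial_function_const[of c]]
      by (simp add: scaleR_conv_of_real mult.commute)
    have basic: "real_polynomial_function (\<lambda>x::real. x)" "real_polynomial_function (\<lambda>x::real. c)" for c
      unfolding real_polynomial_function_eq by auto
    show ?thesis using p
      by (intro polynomial_function_add r real_polynomial_function_power real_polynomial_function_diff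
        real_polynomial_function_divide basic)
  qed
  then obtain q' where "is_wderiv L (?q n) q'" using wderiv_polynomial by blast
  ultimately show ?thesis by blast
qed

lemma wderiv_antiderivative:
  assumes L: "L \<ge> 0" and p: "sqint L p"
  obtains f where "is_wderiv L f p" "f L = 0"
proof -
  define f where "f x = (\<integral>t. indicat_real {..x} t *\<^sub>R p t \<partial>leb0 L) - (\<integral>t. indicat_real {..L} t *\<^sub>R p t \<partial>leb0 L)" for x
  have "(\<integral>t. indicat_real {..0} t *\<^sub>R p t \<partial>leb0 L) = 0"
  proof (rule integral_eq_zero_AE)
    have "AE t in lborel. t \<noteq> (0::real)" by (rule AE_lborel_singleton)
    then have "AE t in leb0 L. t > 0" unfolding AE_leb0 by eventually_elim auto
    then show "AE t in leb0 L. indicat_real {..0} t *\<^sub>R p t = 0" by eventually_elim simp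
  qed
  then have "is_wderiv L f p" by (intro wderivI p) (simp add: f_def)
  then show ?thesis by (rule that) (simp add: f_def)
qed

text \<open>Integrating from L, where f vanishes, bounds \<open>|f x|\<close> by the integral of
  \<open>|f'|\<close>. The estimate \<open>|f'| \<le> s + |f'|^2 / s\<close> with
  \<open>s = sqrt d\<close> stands in for Cauchy-Schwarz and gives
  \<open>L s + d / s = (L + 1) s\<close>; squaring and integrating over length L yields the
  constant.\<close>

lemma poincare_bound:
  assumes L: "L \<ge> 0" and f: "is_wderiv L f f'" "f L = 0" and d: "d > 0" "nsq L f' \<le> d"
  shows "nsq L f \<le> (L + 1)\<^sup>2 * L * d"
proof -
  have sq: "sqint L f'" by (rule wderiv_sqint[OF f(1)])
  have i: "integrable (leb0 L) (\<lambda>x. (norm (f' x))\<^sup>2)" using sq by (simp add: sqint_def)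
  interpret M: finite_measure "leb0 L" by (rule finite_measure_leb0)
  have meas: "measure (leb0 L) (space (leb0 L)) = L"
    using L by (simp add: measure_restrict_space space_restrict_space)
  define s where "s = sqrt d"
  have s: "s > 0" "s\<^sup>2 = d" using d by (auto simp: s_def)
  have bd: "norm (f x) \<le> (L + 1) * s" if x: "x \<in> {0..L}" for x
  proof -
    have iu: "integrable (leb0 L) (\<lambda>t. indicat_real {..y} t *\<^sub>R f' t)" for y
      by (rule integrable_upto[OF sqint_integrable[OF sq]])
    have "f x - f L = (\<integral>t. indicat_real {..x} t *\<^sub>R f' t \<partial>leb0 L) - (\<integral>t. indicat_real {..L} t *\<^sub>R f' t \<partial>leb0 L)"
      using wderiv_eq[OF f(1) x] wderiv_eq[OF f(1), of L] L by simp
    also have "\<dots> = (\<integral>t. indicat_real {..x} t *\<^sub>R f' t - indicat_real {..L} t *\<^sub>R f' t \<partial>leb0 L)"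
      using iu by simp
    finally have "norm (f x) = norm (\<integral>t. indicat_real {..x} t *\<^sub>R f' t - indicat_real {..L} t *\<^sub>R f' t \<partial>leb0 L)"
      using f(2) by simp
    also have "\<dots> \<le> (\<integral>t. norm (indicat_real {..x} t *\<^sub>R f' t - indicat_real {..L} t *\<^sub>R f' t) \<partial>leb0 L)"
      by (rule integral_norm_bound)
    also have "\<dots> \<le> (\<integral>t. s + (norm (f' t))\<^sup>2 / s \<partial>leb0 L)"
    proof (rule Bochner_Integration.integral_mono)
      fix t
      have "norm (indicat_real {..x} t *\<^sub>R f' t - indicat_real {..L} t *\<^sub>R f' t) \<le> norm (f' t)"
        by (auto simp: indicator_def)
      also have "\<dots> \<le> s + (norm (f' t))\<^sup>2 / s"
      proof -
        have "s * norm (f' t) \<le> s\<^sup>2 + (norm (f' t))\<^sup>2"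
        proof -
          have "0 \<le> s * norm (f' t)" using s by simp
          moreover have "2 * (s * norm (f' t)) \<le> s\<^sup>2 + (norm (f' t))\<^sup>2"
            using sum_squares_bound[of s "norm (f' t)"] by simp
          ultimately show ?thesis by linarith
        qed
        then show ?thesis using s by (simp add: field_simps power2_eq_square)
      qed
      finally show "norm (indicat_real {..x} t *\<^sub>R f' t - indicat_real {..L} t *\<^sub>R f' t) \<le> s + (norm (f' t))\<^sup>2 / s" .
    qed (use i iu in auto)
    also have "\<dots> = L * s + nsq L f' / s" using i meas by (simp add: nsq_def)
    also have "\<dots> \<le> L * s + d / s" using d(2) s by (simp add: divide_right_mono)
    also have "\<dots> = (L + 1) * s" using s by (simp add: field_simps power2_eq_square)
    finally show ?thesis .
  qed
  have "sqint L f" by (rule continuous_sqint[OF wderiv_continuous[OF f(1)]])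
  then have "nsq L f \<le> (\<integral>x. ((L + 1) * s)\<^sup>2 \<partial>leb0 L)" unfolding nsq_def
  proof (intro Bochner_Integration.integral_mono)
    fix x assume "x \<in> space (leb0 L)"
    then show "(norm (f x))\<^sup>2 \<le> ((L + 1) * s)\<^sup>2"
      using bd by (intro power_mono) (auto simp: space_restrict_space)
  qed (auto simp: sqint_def)
  also have "\<dots> = (L + 1)\<^sup>2 * L * d" using meas s by (simp add: power_mult_distrib)
  finally show ?thesis .
qed

text \<open>The derivative is approximated first and then integrated back from L: this keeps the
  boundary value and leaves the error of the function itself to
  \<open>poincare_bound\<close>.\<close>

lemma H2_approx:
  assumes L: "L > 0" and f: "is_wderiv L f g" "f L = 0" and d: "d > 0"
  obtains f1 p p' where "is_wderiv L f1 p" "is_wderiv L p p'" "f1 L = 0" "nsq L (\<lambda>x. g x - p x) \<le> d"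
    "nsq L (\<lambda>x. f x - f1 x) \<le> (L + 1)\<^sup>2 * L * d"
proof -
  obtain p p' where p: "is_wderiv L p p'" "nsq L (\<lambda>x. g x - p x) < d"
    using H1_dense[OF L wderiv_sqint[OF f(1)] d] unfolding nsq_def by blast
  obtain f1 where f1: "is_wderiv L f1 p" "f1 L = 0"
    using wderiv_antiderivative[OF less_imp_le[OF L] continuous_sqint[OF wderiv_continuous[OF p(1)]]] by blast
  have "nsq L (\<lambda>x. f x - f1 x) \<le> (L + 1)\<^sup>2 * L * d"
    by (rule poincare_bound[OF less_imp_le[OF L] wderiv_diff[OF f(1) f1(1)] _ d]) (use p f f1 in auto)
  then show ?thesis using that[OF f1(1) p(1) f1(2)] p(2) by simp
qed

section \<open>The Lyapunov functional\<close>

type_synonym cx6 = "complex \<times> complex \<times> complex \<times> complex \<times> complex \<times> complex"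

locale bresse =
  fixes L rho1 rho2 kap b k0 l g1 g2 g3 :: real
  assumes L: "L > 0" and rho1: "rho1 > 0" and rho2: "rho2 > 0" and kap: "kap > 0" and b: "b > 0"
    and k0: "k0 > 0" and l: "l > 0" and g1: "g1 > 0" and g2: "g2 > 0" and g3: "g3 > 0"
begin

text \<open>The square roots turn the standard real inner product of C^6 into the polarised energy
  density, so that general facts about Euclidean spaces apply.\<close>

definition pack :: "complex \<Rightarrow> complex \<Rightarrow> complex \<Rightarrow> complex \<Rightarrow> complex \<Rightarrow> complex \<Rightarrow> cx6" where
  "pack u \<Phi> v \<Psi> z W = (sqrt kap *\<^sub>R u, sqrt rho1 *\<^sub>R \<Phi>, sqrt b *\<^sub>R v, sqrt rho2 *\<^sub>R \<Psi>, sqrt k0 *\<^sub>R z, sqrt rho1 *\<^sub>R W)"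

text \<open>Up to null sets a real-linear isometry of the state space into L^2 with values in C^6,
  as \<open>N_sq\<close> and \<open>T_lin\<close> record; the semigroup is studied through
  it.\<close>

definition T :: "state \<Rightarrow> real \<Rightarrow> cx6" where
  "T U x = (case U of (\<phi>,\<psi>,w,\<Phi>,\<Psi>,W) \<Rightarrow>
     pack (wd L \<phi> x + \<psi> x + complex_of_real l * w x) (\<Phi> x) (wd L \<psi> x) (\<Psi> x)
       (wd L w x - complex_of_real l * \<phi> x) (W x))"

text \<open>It exchanges each strain with the matching velocity. The quotients of roots replace the
  weights of \<open>pack\<close> by the mass densities, so that J is symmetric and
  \<open>inner y (J y)\<close> is the multiplier density \<open>q\<close>.\<close>

definition J :: "cx6 \<Rightarrow> cx6" where
  "J y = (case y of (u,\<Phi>,v,\<Psi>,z,W) \<Rightarrow>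
     ((sqrt rho1 / sqrt kap) *\<^sub>R \<Phi>, (sqrt rho1 / sqrt kap) *\<^sub>R u,
      (sqrt rho2 / sqrt b) *\<^sub>R \<Psi>, (sqrt rho2 / sqrt b) *\<^sub>R v,
      (sqrt rho1 / sqrt k0) *\<^sub>R W, (sqrt rho1 / sqrt k0) *\<^sub>R z))"

lemma sqrt_mult_sqrt: "p > 0 \<Longrightarrow> sqrt p * (sqrt p * r) = p * r"
  by (simp flip: mult.assoc)

lemma inner_pack:
  "inner (pack u \<Phi> v \<Psi> z W) (pack u' \<Phi>' v' \<Psi>' z' W') =
     kap * inner u u' + rho1 * inner \<Phi> \<Phi>' + b * inner v v' + rho2 * inner \<Psi> \<Psi>' + k0 * inner z z' + rho1 * inner W W'"
  using rho1 rho2 kap b k0 by (simp add: pack_def inner_prod_def sqrt_mult_sqrt)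

lemma inner_J_pack:
  "inner (pack u \<Phi> v \<Psi> z W) (J (pack u' \<Phi>' v' \<Psi>' z' W')) =
     rho1 * (inner u \<Phi>' + inner \<Phi> u') + rho2 * (inner v \<Psi>' + inner \<Psi> v') + rho1 * (inner z W' + inner W z')"
  using rho1 rho2 kap b k0 by (simp add: pack_def J_def inner_prod_def sqrt_mult_sqrt algebra_simps)

lemma pack_add: "pack u \<Phi> v \<Psi> z W + c *\<^sub>R pack u' \<Phi>' v' \<Psi>' z' W' =
   pack (u + c *\<^sub>R u') (\<Phi> + c *\<^sub>R \<Phi>') (v + c *\<^sub>R v') (\<Psi> + c *\<^sub>R \<Psi>') (z + c *\<^sub>R z') (W + c *\<^sub>R W')"
  by (simp add: pack_def scaleR_add_right mult.commute)

lemma pack_diff: "pack u \<Phi> v \<Psi> z W - pack u' \<Phi>' v' \<Psi>' z' W' =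
   pack (u - u') (\<Phi> - \<Phi>') (v - v') (\<Psi> - \<Psi>') (z - z') (W - W')"
  by (simp add: pack_def scaleR_diff_right)

lemma bounded_linear_J: "bounded_linear J"
proof -
  have eq: "J = (\<lambda>y. ((sqrt rho1 / sqrt kap) *\<^sub>R fst (snd y), (sqrt rho1 / sqrt kap) *\<^sub>R fst y,
      (sqrt rho2 / sqrt b) *\<^sub>R fst (snd (snd (snd y))), (sqrt rho2 / sqrt b) *\<^sub>R fst (snd (snd y)),
      (sqrt rho1 / sqrt k0) *\<^sub>R snd (snd (snd (snd (snd y)))), (sqrt rho1 / sqrt k0) *\<^sub>R fst (snd (snd (snd (snd y))))))"
    by (simp add: J_def fun_eq_iff)
  show ?thesis unfolding eq
    by (intro bounded_linear_Pair bounded_linear_const_scaleR bounded_linear_fst bounded_linear_snd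
       bounded_linear_compose[OF bounded_linear_fst] bounded_linear_compose[OF bounded_linear_snd])
qed

lemma J_symmetric: "inner y (J y') = inner y' (J y)"
  by (cases y; cases y') (simp add: J_def inner_prod_def inner_commute algebra_simps)

text \<open>One summand for each product in the remainder: \<open>u\<close> with \<open>z\<close>,
  \<open>\<Phi>\<close> with \<open>\<Psi>\<close>, \<open>u\<close> with \<open>v\<close>. Each is
  the coefficient of the product times the constant of \<open>cross_term\<close>.\<close>

definition C0 :: real where
  "C0 = \<bar>k0 - kap\<bar> * l * (1/kap + 1/k0) + rho1 * (1/rho1 + 1/rho2) + kap * (1/kap + 1/b)"

lemma C0_pos: "C0 > 0"
  unfolding C0_def using rho1 rho2 kap b k0 l
  by (intro add_nonneg_pos mult_nonneg_nonneg mult_pos_pos add_pos_pos divide_pos_pos) auto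

definition m :: "real \<Rightarrow> real" where "m x = 1 - exp (C0 * (L - x))"
definition m' :: "real \<Rightarrow> real" where "m' x = C0 * exp (C0 * (L - x))"

lemma m_bounds:
  assumes "x \<in> {0..L}"
  shows "m x \<le> 0" "\<bar>m x\<bar> \<le> exp (C0 * L)" "m' x = C0 * (\<bar>m x\<bar> + 1)"
proof -
  have "C0 * (L - x) \<ge> 0" using assms C0_pos by auto
  then have 1: "exp (C0 * (L - x)) \<ge> 1" by simp
  have "C0 * (L - x) \<le> C0 * L" using assms C0_pos by auto
  then have 2: "exp (C0 * (L - x)) \<le> exp (C0 * L)" by simp
  show "m x \<le> 0" "\<bar>m x\<bar> \<le> exp (C0 * L)"
    unfolding m_def using 1 2 by linarith+
  have "\<bar>m x\<bar> + 1 = exp (C0 * (L - x))" unfolding m_def using 1 by linarith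
  then show "m' x = C0 * (\<bar>m x\<bar> + 1)" by (simp add: m'_def)
qed

text \<open>Polar form of the density \<open>e + \<epsilon> m q\<close> at the point x. Bilinearity
  allows a finite time step to be expanded exactly and \<open>A\<close> to be tested like a
  dissipative operator.\<close>

definition form :: "real \<Rightarrow> real \<Rightarrow> cx6 \<Rightarrow> cx6 \<Rightarrow> real" where
  "form \<epsilon> x y y' = inner y y' + \<epsilon> * m x * inner y (J y')"

lemma cross_term:
  fixes a c :: complex
  assumes "p > 0" "q > 0" "p * (norm a)\<^sup>2 \<le> e" "q * (norm c)\<^sup>2 \<le> e"
  shows "2 * \<bar>inner a c\<bar> \<le> (1/p + 1/q) * e"
proof -
  have "2 * \<bar>inner a c\<bar> \<le> 2 * (norm a * norm c)" using Cauchy_Schwarz_ineq2[of a c] by simp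
  also have "\<dots> \<le> (norm a)\<^sup>2 + (norm c)\<^sup>2" using sum_squares_bound[of "norm a" "norm c"] by simp
  also have "\<dots> \<le> e / p + e / q" using assms by (intro add_mono) (auto simp: field_simps)
  finally show ?thesis by (simp add: algebra_simps)
qed

lemma remainder_bound:
  fixes u \<Phi> v \<Psi> z W :: complex
  defines "e \<equiv> inner (pack u \<Phi> v \<Psi> z W) (pack u \<Phi> v \<Psi> z W)"
  shows "\<bar>2 * ((k0 - kap) * l * inner u z + rho1 * inner \<Phi> \<Psi> - kap * inner u v)\<bar> \<le> C0 * e"
proof -
  have e: "e = kap * (norm u)\<^sup>2 + rho1 * (norm \<Phi>)\<^sup>2 + b * (norm v)\<^sup>2 + rho2 * (norm \<Psi>)\<^sup>2 + k0 * (norm z)\<^sup>2 + rho1 * (norm W)\<^sup>2"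
    by (simp add: e_def inner_pack power2_norm_eq_inner)
  note pos = rho1 rho2 kap b k0
  have nn: "0 \<le> kap * (norm u)\<^sup>2" "0 \<le> rho1 * (norm \<Phi>)\<^sup>2" "0 \<le> b * (norm v)\<^sup>2" "0 \<le> rho2 * (norm \<Psi>)\<^sup>2"
    "0 \<le> k0 * (norm z)\<^sup>2" "0 \<le> rho1 * (norm W)\<^sup>2"
    using pos by auto
  have 1: "2 * \<bar>inner u z\<bar> \<le> (1/kap + 1/k0) * e" by (rule cross_term) (use pos nn in \<open>simp_all add: e\<close>)
  have 2: "2 * \<bar>inner \<Phi> \<Psi>\<bar> \<le> (1/rho1 + 1/rho2) * e" by (rule cross_term) (use pos nn in \<open>simp_all add: e\<close>)
  have 3: "2 * \<bar>inner u v\<bar> \<le> (1/kap + 1/b) * e" by (rule cross_term) (use pos nn in \<open>simp_all add: e\<close>)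
  have "\<bar>2 * ((k0 - kap) * l * inner u z + rho1 * inner \<Phi> \<Psi> - kap * inner u v)\<bar>
     \<le> \<bar>k0 - kap\<bar> * l * (2 * \<bar>inner u z\<bar>) + rho1 * (2 * \<bar>inner \<Phi> \<Psi>\<bar>) + kap * (2 * \<bar>inner u v\<bar>)"
  proof -
    have "\<bar>(k0 - kap) * l * inner u z\<bar> = \<bar>k0 - kap\<bar> * l * \<bar>inner u z\<bar>" "\<bar>rho1 * inner \<Phi> \<Psi>\<bar> = rho1 * \<bar>inner \<Phi> \<Psi>\<bar>"
      "\<bar>kap * inner u v\<bar> = kap * \<bar>inner u v\<bar>"
      using l rho1 kap by (simp_all add: abs_mult)
    then have "\<bar>k0 - kap\<bar> * l * (2 * \<bar>inner u z\<bar>) + rho1 * (2 * \<bar>inner \<Phi> \<Psi>\<bar>) + kap * (2 * \<bar>inner u v\<bar>)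
       = 2 * (\<bar>(k0 - kap) * l * inner u z\<bar> + \<bar>rho1 * inner \<Phi> \<Psi>\<bar> + \<bar>kap * inner u v\<bar>)"
      by (simp only:) (simp add: algebra_simps)
    moreover have "\<bar>2 * (X + Y - Z)\<bar> \<le> 2 * (\<bar>X\<bar> + \<bar>Y\<bar> + \<bar>Z\<bar>)" for X Y Z :: real
      by (simp add: abs_if)
    ultimately show ?thesis by (simp only:)
  qed
  also have "\<dots> \<le> \<bar>k0 - kap\<bar> * l * ((1/kap + 1/k0) * e) + rho1 * ((1/rho1 + 1/rho2) * e) + kap * ((1/kap + 1/b) * e)"
    using 1 2 3 l rho1 kap by (intro add_mono mult_left_mono) auto
  also have "\<dots> = C0 * e" by (simp add: C0_def algebra_simps)
  finally show ?thesis .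
qed

section \<open>Representatives of weak derivatives and their boundary value\<close>

lemma wd_wderiv: "H1 L f \<Longrightarrow> is_wderiv L f (wd L f)"
  unfolding H1_def wd_def using someI_ex[of "is_wderiv L f"] by blast

lemma wd_AE: "is_wderiv L f g \<Longrightarrow> AE x in leb0 L. wd L f x = g x"
  by (rule wderiv_unique[OF less_imp_le[OF L] wd_wderiv]) (auto simp: H1_def)

text \<open>Two derivatives of f agree almost everywhere, which by itself says nothing at an
  endpoint; with continuity, a difference at 0 would persist on an interval of positive length. This
  makes \<open>dval0\<close> well defined.\<close>

lemma wderiv_value_0:
  assumes g: "is_wderiv L f g" "continuous_on {0..L} g" and k: "is_wderiv L f k" "continuous_on {0..L} k"
  shows "g 0 = k 0"
proof (rule ccontr)
  have ae: "AE x in leb0 L. g x = k x" by (rule wderiv_unique[OF less_imp_le[OF L] g(1) k(1)])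
  assume "g 0 \<noteq> k 0"
  then have p: "norm (g 0 - k 0) > 0" by simp
  have "continuous (at 0 within {0..L}) (\<lambda>x. g x - k x)"
    using continuous_on_diff[OF g(2) k(2)] L by (auto simp: continuous_on_eq_continuous_within)
  then obtain d where d: "d > 0" "\<And>x. x \<in> {0..L} \<Longrightarrow> dist x 0 < d \<Longrightarrow> dist (g x - k x) (g 0 - k 0) < norm (g 0 - k 0)"
    using p unfolding continuous_within_eps_delta by blast
  have ne: "g x \<noteq> k x" if "x \<in> {0<..<min d L}" for x
    using d(2)[of x] that by (auto simp: dist_norm norm_minus_commute)
  have "AE x in lborel. x \<notin> {0<..<min d L}"
    using ae unfolding AE_leb0 by eventually_elim (use ne in force)
  then have "emeasure lborel {0<..<min d L} = 0"
    by (subst (asm) AE_iff_measurable[of "{0<..<min d L}"]) auto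
  then show False using d(1) L by (simp add: min_def split: if_splits)
qed

lemma dval0_eq:
  assumes "is_wderiv L f g" "is_wderiv L g h"
  shows "dval0 L f = g 0"
proof -
  have "\<exists>c. \<exists>g h. is_wderiv L f g \<and> is_wderiv L g h \<and> g 0 = c" using assms by blast
  from someI_ex[OF this] obtain k h' where k: "is_wderiv L f k" "is_wderiv L k h'" "k 0 = dval0 L f"
    unfolding dval0_def by blast
  show ?thesis
    using wderiv_value_0[OF assms(1) wderiv_continuous[OF assms(2)] k(1) wderiv_continuous[OF k(2)]] k(3) by simp
qed

text \<open>\<open>wd L f\<close> is some square-integrable derivative and need not be continuous at
  0. Here a single continuous representative is found that fits both other choices,
  \<open>wd2\<close> and \<open>dval0\<close>.\<close>

lemma H2_reps:
  assumes "H2 L f"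
  obtains g where "is_wderiv L f g" "is_wderiv L g (wd2 L f)" "g 0 = dval0 L f"
proof -
  have "\<exists>h g. is_wderiv L f g \<and> is_wderiv L g h" using assms unfolding H2_def by blast
  from someI_ex[OF this] obtain g where g: "is_wderiv L f g" "is_wderiv L g (wd2 L f)"
    unfolding wd2_def by blast
  then show ?thesis using dval0_eq[OF g] that by simp
qed

lemma T_AE:
  assumes "is_wderiv L \<phi> u" "is_wderiv L \<psi> v" "is_wderiv L w z"
  shows "AE x in leb0 L. T (\<phi>,\<psi>,w,\<Phi>,\<Psi>,W) x =
     pack (u x + \<psi> x + complex_of_real l * w x) (\<Phi> x) (v x) (\<Psi> x) (z x - complex_of_real l * \<phi> x) (W x)"
  using wd_AE[OF assms(1)] wd_AE[OF assms(2)] wd_AE[OF assms(3)]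
  by eventually_elim (simp add: T_def)

text \<open>The strains of \<open>A U\<close> are formed from its first three components, the
  velocities of \<open>U\<close>; this is where the system in the six energy variables
  closes.\<close>

lemma Aop_T_AE:
  assumes "is_wderiv L \<phi> u" "is_wderiv L \<psi> v" "is_wderiv L w z"
    "is_wderiv L \<Phi> \<Phi>'" "is_wderiv L \<Psi> \<Psi>'" "is_wderiv L W W'"
  shows "AE x in leb0 L. T (Aop L rho1 rho2 kap b k0 l (\<phi>,\<psi>,w,\<Phi>,\<Psi>,W)) x =
     pack (\<Phi>' x + \<Psi> x + complex_of_real l * W x)
       ((kap / rho1) *\<^sub>R (wd2 L \<phi> x + v x + complex_of_real l * z x) + (k0 * l / rho1) *\<^sub>R (z x - complex_of_real l * \<phi> x))
       (\<Psi>' x)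
       ((b / rho2) *\<^sub>R wd2 L \<psi> x - (kap / rho2) *\<^sub>R (u x + \<psi> x + complex_of_real l * w x))
       (W' x - complex_of_real l * \<Phi> x)
       ((k0 / rho1) *\<^sub>R (wd2 L w x - complex_of_real l * u x) - (kap * l / rho1) *\<^sub>R (u x + \<psi> x + complex_of_real l * w x))"
  using assms[THEN wd_AE]
  by eventually_elim (simp add: T_def Aop_def scaleR_conv_of_real)

section \<open>Integration by parts and the dissipation inequality\<close>

definition ac :: "(real \<Rightarrow> real) \<Rightarrow> (real \<Rightarrow> real) \<Rightarrow> bool" where
  "ac F F' \<longleftrightarrow> integrable (leb0 L) F' \<and> (\<integral>x. F' x \<partial>leb0 L) = F L - F 0"

lemma ac_add: "ac F F' \<Longrightarrow> ac G G' \<Longrightarrow> ac (\<lambda>x. F x + G x) (\<lambda>x. F' x + G' x)"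
  by (simp add: ac_def)

lemma ac_cmult: "ac F F' \<Longrightarrow> ac (\<lambda>x. c * F x) (\<lambda>x. c * F' x)"
  by (simp add: ac_def right_diff_distrib[symmetric])

lemma ac_inner:
  assumes "is_wderiv L f f'" "is_wderiv L g g'"
  shows "ac (\<lambda>x. inner (f x) (g x)) (\<lambda>x. inner (f' x) (g x) + inner (f x) (g' x))"
proof -
  let ?h = "\<lambda>x. f' x * cnj (g x) + f x * cnj (g' x)"
  have w: "is_wderiv L (\<lambda>x. f x * cnj (g x)) ?h"
    by (intro wderiv_mult wderiv_cnj assms)
  have i: "integrable (leb0 L) ?h" by (rule sqint_integrable[OF wderiv_sqint[OF w]])
  have in_eq: "inner a c = Re (a * cnj c)" for a c :: complex by (simp add: inner_complex_def)
  have "f L * cnj (g L) = f 0 * cnj (g 0) + (\<integral>x. indicat_real {..L} x *\<^sub>R ?h x \<partial>leb0 L)"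
    using wderiv_eq[OF w, of L] L by simp
  also have "(\<integral>x. indicat_real {..L} x *\<^sub>R ?h x \<partial>leb0 L) = (\<integral>x. ?h x \<partial>leb0 L)"
    by (rule Bochner_Integration.integral_cong) (auto simp: space_restrict_space)
  finally have "(\<integral>x. ?h x \<partial>leb0 L) = f L * cnj (g L) - f 0 * cnj (g 0)" by simp
  then have "(\<integral>x. Re (?h x) \<partial>leb0 L) = Re (f L * cnj (g L)) - Re (f 0 * cnj (g 0))"
    unfolding integral_Re[OF i] by simp
  then show ?thesis using integrable_Re[OF i] unfolding ac_def in_eq by simp
qed

lemma wderiv_m: "is_wderiv L (\<lambda>x. complex_of_real (m x)) (\<lambda>x. complex_of_real (m' x))"
proof (rule wderiv_C1)
  fix x assume "x \<in> {0..L}"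
  have "(m has_vector_derivative m' x) (at x within {0..L})"
    unfolding m_def[abs_def] m'_def has_real_derivative_iff_has_vector_derivative[symmetric]
    by (auto intro!: derivative_eq_intros)
  then show "((\<lambda>x. complex_of_real (m x)) has_vector_derivative complex_of_real (m' x)) (at x within {0..L})"
    by (rule bounded_linear.has_vector_derivative[OF bounded_linear_of_real])
next
  show "continuous_on {0..L} (\<lambda>x. complex_of_real (m' x))"
    unfolding m'_def by (intro continuous_intros)
qed

lemma ac_m_inner:
  assumes "is_wderiv L f f'"
  shows "ac (\<lambda>x. m x * inner (f x) (f x)) (\<lambda>x. m' x * inner (f x) (f x) + m x * (2 * inner (f x) (f' x)))"
proof -
  have "ac (\<lambda>x. inner (complex_of_real (m x) * f x) (f x))
     (\<lambda>x. inner (complex_of_real (m' x) * f x + complex_of_real (m x) * f' x) (f x) + inner (complex_of_real (m x) * f x) (f' x))"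
    by (intro ac_inner wderiv_mult wderiv_m assms)
  then show ?thesis
    unfolding scaleR_conv_of_real[symmetric] inner_add_left inner_scaleR_left
    by (simp add: inner_commute algebra_simps)
qed


text \<open>The pointwise identity behind the Lyapunov estimate; primed variables are \<open>x\<close>-derivatives,
  and \<open>V\<close> is the value of \<open>T (A U)\<close>.\<close>
lemma dissipation_identity:
  fixes u \<Phi> v \<Psi> z W u' \<Phi>' v' \<Psi>' z' W' :: complex
  defines "U \<equiv> pack u \<Phi> v \<Psi> z W"
  defines "U' \<equiv> pack u' \<Phi>' v' \<Psi>' z' W'"
  defines "V \<equiv> pack (\<Phi>' + \<Psi> + complex_of_real l * W) ((kap / rho1) *\<^sub>R u' + (k0 * l / rho1) *\<^sub>R z)
       \<Psi>' ((b / rho2) *\<^sub>R v' - (kap / rho2) *\<^sub>R u)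
       (W' - complex_of_real l * \<Phi>) ((k0 / rho1) *\<^sub>R z' - (kap * l / rho1) *\<^sub>R u)"
  shows "2 * form \<epsilon> x U V =
     2 * (kap * (inner u' \<Phi> + inner u \<Phi>') + b * (inner v' \<Psi> + inner v \<Psi>') + k0 * (inner z' W + inner z W'))
     + \<epsilon> * m x * (kap * (2 * inner u u') + rho1 * (2 * inner \<Phi> \<Phi>') + b * (2 * inner v v') + rho2 * (2 * inner \<Psi> \<Psi>')
         + k0 * (2 * inner z z') + rho1 * (2 * inner W W'))
     + \<epsilon> * m x * (2 * ((k0 - kap) * l * inner u z + rho1 * inner \<Phi> \<Psi> - kap * inner u v))"
proof -
  have c: "complex_of_real l * y = l *\<^sub>R y" for y by (simp add: scaleR_conv_of_real)
  have r: "rho1 \<noteq> 0" "rho2 \<noteq> 0" using rho1 rho2 by auto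
  have 1: "inner U V = kap * (inner u' \<Phi> + inner u \<Phi>') + b * (inner v' \<Psi> + inner v \<Psi>') + k0 * (inner z' W + inner z W')"
    unfolding U_def V_def inner_pack c using r
    by (simp add: inner_add_right inner_diff_right inner_commute field_simps)
  have 2: "inner U (J V) = (kap * inner u u' + rho1 * inner \<Phi> \<Phi>' + b * inner v v' + rho2 * inner \<Psi> \<Psi>'
         + k0 * inner z z' + rho1 * inner W W') + ((k0 - kap) * l * inner u z + rho1 * inner \<Phi> \<Psi> - kap * inner u v)"
    unfolding U_def V_def inner_J_pack c using r
    by (simp add: inner_add_right inner_diff_right inner_commute field_simps)
  show ?thesis unfolding form_def 1 2 by (simp add: algebra_simps)
qed

text \<open>For strain a and velocity c at x = 0 with \<open>p a = g c\<close>, the damper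
  dissipates \<open>2 g |c|^2\<close>, while the weighted boundary energy is at most
  \<open>\<epsilon> exp (C0 L) (g^2/p + r) |c|^2\<close>. Each quotient is the largest \<epsilon>
  for which the first covers the second.\<close>

definition eps0 :: real where
  "eps0 = Min {2 * g1 / (exp (C0 * L) * (g1\<^sup>2 / kap + rho1)), 2 * g2 / (exp (C0 * L) * (g2\<^sup>2 / b + rho2)),
     2 * g3 / (exp (C0 * L) * (g3\<^sup>2 / k0 + rho1))}"

lemma eps0_pos: "eps0 > 0"
  unfolding eps0_def using g1 g2 g3 kap b k0 rho1 rho2 by (simp add: add_nonneg_pos)

lemma boundary_term:
  assumes "p > 0" "r > 0" "g > 0" "p *\<^sub>R a = g *\<^sub>R c" "0 \<le> \<epsilon>" "\<epsilon> \<le> 2 * g / (exp (C0 * L) * (g\<^sup>2 / p + r))"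
  shows "0 \<le> 2 * (p * inner a c) + \<epsilon> * (m 0 * (p * inner a a + r * inner c (c::complex)))"
proof -
  have a: "a = (g / p) *\<^sub>R c" using assms(1,4)
    by (metis (no_types, lifting) divide_inverse_commute less_irrefl real_vector.scale_left_imp_eq scaleR_scaleR right_inverse mult.assoc mult_1)
  let ?X = "g\<^sup>2 / p + r"
  have X: "?X > 0" using assms by (simp add: add_nonneg_pos)
  define N where "N = inner c c"
  have N: "N \<ge> 0" by (simp add: N_def)
  have 1: "p * inner a a + r * inner c c = ?X * N"
    unfolding a N_def using assms(1) by (simp add: field_simps power2_eq_square)
  have 2: "p * inner a c = g * N" unfolding a N_def using assms(1) by simp
  have "\<epsilon> * (exp (C0 * L) * ?X) \<le> 2 * g"
    using assms(6) X by (simp add: pos_le_divide_eq)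
  from mult_right_mono[OF this N] have 3: "\<epsilon> * (exp (C0 * L) * (?X * N)) \<le> 2 * (g * N)"
    by (simp only: mult.assoc)
  have "- m 0 \<le> exp (C0 * L)" using m_bounds(2)[of 0] L by simp
  then have "- m 0 * (?X * N) \<le> exp (C0 * L) * (?X * N)"
    by (rule mult_right_mono) (use X N in simp)
  from mult_left_mono[OF this assms(5)] have "\<epsilon> * (- m 0 * (?X * N)) \<le> \<epsilon> * (exp (C0 * L) * (?X * N))" .
  moreover have "\<epsilon> * (- m 0 * (?X * N)) = - (\<epsilon> * (m 0 * (?X * N)))" by simp
  ultimately show ?thesis unfolding 1 2 using 3 by linarith
qed

text \<open>This is the purpose of the weight: in \<open>m' = C0 (\<bar>m\<bar> + 1)\<close> the
  summand \<open>\<bar>m\<bar>\<close> absorbs the remainder and the summand 1 survives as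
  dissipation of the whole energy density.\<close>

lemma weight_bound:
  assumes "x \<in> {0..L}" "\<bar>R\<bar> \<le> C0 * E" "0 \<le> \<epsilon>"
  shows "\<epsilon> * (m x * R) + \<epsilon> * (C0 * E) \<le> \<epsilon> * (m' x * E)"
proof -
  have "m x * R \<le> \<bar>m x\<bar> * \<bar>R\<bar>" by (simp flip: abs_mult)
  also have "\<dots> \<le> \<bar>m x\<bar> * (C0 * E)" using assms(2) by (rule mult_left_mono) simp
  finally have "m x * R + C0 * E \<le> m' x * E"
    unfolding m_bounds(3)[OF assms(1)] by (simp add: algebra_simps)
  from mult_left_mono[OF this assms(3)] show ?thesis by (simp add: distrib_left)
qed

text \<open>Dissipativity of \<open>A\<close> in the modified inner product, strict for positive
  \<epsilon>; no semigroup is involved. Pointwise, the left integrand plus the dissipation is at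
  most the derivative of a flux \<open>?F\<close> whose boundary contribution
  \<open>?F L - ?F 0\<close> is not positive.\<close>

lemma lyapunov_static:
  assumes U: "U \<in> DA L kap b k0 l g1 g2 g3" and eps: "0 \<le> \<epsilon>" "\<epsilon> \<le> eps0"
    and int: "integrable (leb0 L) (\<lambda>x. form \<epsilon> x (T U x) (T (Aop L rho1 rho2 kap b k0 l U) x))"
      "integrable (leb0 L) (\<lambda>x. (norm (T U x))\<^sup>2)"
  shows "2 * (\<integral>x. form \<epsilon> x (T U x) (T (Aop L rho1 rho2 kap b k0 l U) x) \<partial>leb0 L)
     \<le> - \<epsilon> * C0 * (\<integral>x. (norm (T U x))\<^sup>2 \<partial>leb0 L)"
proof -
  obtain \<phi> \<psi> w \<Phi> \<Psi> W where Ueq: "U = (\<phi>,\<psi>,w,\<Phi>,\<Psi>,W)" by (cases U)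
  from U have H: "H2 L \<phi>" "H2 L \<psi>" "H2 L w" "H1 L \<Phi>" "H1 L \<Psi>" "H1 L W" "\<Phi> L = 0" "\<Psi> L = 0" "W L = 0"
    and bc: "complex_of_real kap * (dval0 L \<phi> + \<psi> 0 + complex_of_real l * w 0) = complex_of_real g1 * \<Phi> 0"
      "complex_of_real b * dval0 L \<psi> = complex_of_real g2 * \<Psi> 0"
      "complex_of_real k0 * (dval0 L w - complex_of_real l * \<phi> 0) = complex_of_real g3 * W 0"
    by (auto simp: Ueq DA_def H1L_def)
  obtain dp where dp: "is_wderiv L \<phi> dp" "is_wderiv L dp (wd2 L \<phi>)" "dp 0 = dval0 L \<phi>" using H2_reps[OF H(1)] by blast
  obtain dq where dq: "is_wderiv L \<psi> dq" "is_wderiv L dq (wd2 L \<psi>)" "dq 0 = dval0 L \<psi>" using H2_reps[OF H(2)] by blast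
  obtain dw where dw: "is_wderiv L w dw" "is_wderiv L dw (wd2 L w)" "dw 0 = dval0 L w" using H2_reps[OF H(3)] by blast
  note dP = wd_wderiv[OF H(4)] and dQ = wd_wderiv[OF H(5)] and dW = wd_wderiv[OF H(6)]
  define \<Phi>' \<Psi>' W' where "\<Phi>' = wd L \<Phi>" and "\<Psi>' = wd L \<Psi>" and "W' = wd L W"
  note D = dP[folded \<Phi>'_def] dQ[folded \<Psi>'_def] dW[folded W'_def]
  \<comment> \<open>Built from the continuous derivatives \<open>dp\<close>, \<open>dq\<close>,
    \<open>dw\<close> and not from \<open>wd\<close>, because the boundary conditions below use
    point values at 0.\<close>
  define u u' where "u = (\<lambda>x. dp x + \<psi> x + complex_of_real l * w x)"
    and "u' = (\<lambda>x. wd2 L \<phi> x + dq x + complex_of_real l * dw x)"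
  define z z' where "z = (\<lambda>x. dw x - complex_of_real l * \<phi> x)" and "z' = (\<lambda>x. wd2 L w x - complex_of_real l * dp x)"
  define v v' where "v = dq" and "v' = wd2 L \<psi>"
  have u: "is_wderiv L u u'" unfolding u_def u'_def by (intro wderiv_add wderiv_cmult dp dq dw)
  have z: "is_wderiv L z z'" unfolding z_def z'_def by (intro wderiv_diff wderiv_cmult dp dq dw)
  have v: "is_wderiv L v v'" unfolding v_def v'_def by (rule dq(2))
  have TU: "AE x in leb0 L. T U x = pack (u x) (\<Phi> x) (v x) (\<Psi> x) (z x) (W x)"
    unfolding Ueq u_def v_def z_def by (rule T_AE[OF dp(1) dq(1) dw(1)])
  have TA: "AE x in leb0 L. T (Aop L rho1 rho2 kap b k0 l U) x =
    pack (\<Phi>' x + \<Psi> x + complex_of_real l * W x) ((kap / rho1) *\<^sub>R u' x + (k0 * l / rho1) *\<^sub>R z x)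
       (\<Psi>' x) ((b / rho2) *\<^sub>R v' x - (kap / rho2) *\<^sub>R u x)
       (W' x - complex_of_real l * \<Phi> x) ((k0 / rho1) *\<^sub>R z' x - (kap * l / rho1) *\<^sub>R u x)"
    unfolding Ueq u_def v_def z_def u'_def v'_def z'_def by (rule Aop_T_AE[OF dp(1) dq(1) dw(1) D])
  let ?e = "\<lambda>f x. inner (f x) (f x)"
  \<comment> \<open>Energy flux, that is stress times velocity, plus the weighted energy density
    \<open>\<epsilon> m e\<close>.\<close>
  let ?F = "\<lambda>x. 2 * (kap * inner (u x) (\<Phi> x) + b * inner (v x) (\<Psi> x) + k0 * inner (z x) (W x))
     + \<epsilon> * (kap * (m x * ?e u x) + rho1 * (m x * ?e \<Phi> x) + b * (m x * ?e v x) + rho2 * (m x * ?e \<Psi> x) + k0 * (m x * ?e z x) + rho1 * (m x * ?e W x))"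
  let ?d = "\<lambda>f f' x. m' x * inner (f x) (f x) + m x * (2 * inner (f x) (f' x))"
  let ?F' = "\<lambda>x. 2 * (kap * (inner (u' x) (\<Phi> x) + inner (u x) (\<Phi>' x)) + b * (inner (v' x) (\<Psi> x) + inner (v x) (\<Psi>' x)) + k0 * (inner (z' x) (W x) + inner (z x) (W' x)))
     + \<epsilon> * (kap * ?d u u' x + rho1 * ?d \<Phi> \<Phi>' x + b * ?d v v' x + rho2 * ?d \<Psi> \<Psi>' x + k0 * ?d z z' x + rho1 * ?d W W' x)"
  \<comment> \<open>\<open>?F'\<close> has exactly the shape that the closure rules of
    \<open>ac\<close> produce, so it is obtained term by term.\<close>
  have F: "ac ?F ?F'"
    by (intro ac_add ac_cmult ac_inner ac_m_inner u v z D)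
  \<comment> \<open>The velocities vanish at L, which kills the flux; the strains need not, and
    their energy is removed by \<open>m L = 0\<close>.\<close>
  have FL: "?F L = 0" using H by (simp add: m_def)
  have bc': "kap *\<^sub>R u 0 = g1 *\<^sub>R \<Phi> 0" "b *\<^sub>R v 0 = g2 *\<^sub>R \<Psi> 0" "k0 *\<^sub>R z 0 = g3 *\<^sub>R W 0"
    using bc by (simp_all add: u_def v_def z_def scaleR_conv_of_real dp(3) dq(3) dw(3))
  have le: "\<epsilon> \<le> 2 * g1 / (exp (C0 * L) * (g1\<^sup>2 / kap + rho1))" "\<epsilon> \<le> 2 * g2 / (exp (C0 * L) * (g2\<^sup>2 / b + rho2))"
    "\<epsilon> \<le> 2 * g3 / (exp (C0 * L) * (g3\<^sup>2 / k0 + rho1))"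
    using eps(2) unfolding eps0_def by auto
  have F0: "?F 0 \<ge> 0"
    using boundary_term[OF kap rho1 g1 bc'(1) eps(1) le(1)] boundary_term[OF b rho2 g2 bc'(2) eps(1) le(2)]
      boundary_term[OF k0 rho1 g3 bc'(3) eps(1) le(3)]
    by (simp add: algebra_simps)
  have "2 * (\<integral>x. form \<epsilon> x (T U x) (T (Aop L rho1 rho2 kap b k0 l U) x) \<partial>leb0 L) + \<epsilon> * C0 * (\<integral>x. (norm (T U x))\<^sup>2 \<partial>leb0 L)
     = (\<integral>x. 2 * form \<epsilon> x (T U x) (T (Aop L rho1 rho2 kap b k0 l U) x) + \<epsilon> * C0 * (norm (T U x))\<^sup>2 \<partial>leb0 L)"
    using int by simp
  also have "\<dots> \<le> (\<integral>x. ?F' x \<partial>leb0 L)"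
  proof (rule integral_mono_AE)
    show "integrable (leb0 L) ?F'" using F by (simp add: ac_def)
    have sp: "AE x in leb0 L. x \<in> {0..L}" unfolding AE_leb0 by simp
    show "AE x in leb0 L. 2 * form \<epsilon> x (T U x) (T (Aop L rho1 rho2 kap b k0 l U) x) + \<epsilon> * C0 * (norm (T U x))\<^sup>2 \<le> ?F' x"
      using TU TA sp
    proof eventually_elim
      case (elim x)
      let ?R = "2 * ((k0 - kap) * l * inner (u x) (z x) + rho1 * inner (\<Phi> x) (\<Psi> x) - kap * inner (u x) (v x))"
      let ?E = "inner (T U x) (T U x)"
      have R: "\<bar>?R\<bar> \<le> C0 * ?E" using remainder_bound[of "u x" "z x" "\<Phi> x" "\<Psi> x" "v x" "W x"] elim(1) by simp
      have E: "?E = kap * ?e u x + rho1 * ?e \<Phi> x + b * ?e v x + rho2 * ?e \<Psi> x + k0 * ?e z x + rho1 * ?e W x"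
        unfolding elim(1) inner_pack ..
      \<comment> \<open>The integrand and \<open>?F'\<close> differ by the terms \<open>m' e\<close>
        and \<open>m R\<close>, exactly those that \<open>weight_bound\<close> compares with the
        dissipation.\<close>
      have "2 * form \<epsilon> x (T U x) (T (Aop L rho1 rho2 kap b k0 l U) x) = ?F' x - \<epsilon> * (m' x * ?E) + \<epsilon> * (m x * ?R)"
        unfolding E unfolding elim(1,2) dissipation_identity by (simp add: algebra_simps)
      moreover have "\<epsilon> * C0 * (norm (T U x))\<^sup>2 = \<epsilon> * (C0 * ?E)" by (simp add: power2_norm_eq_inner)
      ultimately show ?case using weight_bound[OF elim(3) R eps(1)] by linarith
    qed
  qed (use int in simp)
  also have "\<dots> = ?F L - ?F 0" using F by (simp add: ac_def)
  also have "\<dots> \<le> 0" using FL F0 by simp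
  finally show ?thesis by simp
qed

end

text \<open>The accumulated error is bounded crudely by \<open>n c\<close> instead of a geometric
  sum. This is enough in the application, where n steps of length \<open>h = t/n\<close> are made
  and \<open>c / h\<close> tends to 0.\<close>

lemma discrete_gronwall:
  fixes f :: "nat \<Rightarrow> real"
  assumes "\<And>k. f (Suc k) \<le> (1 - r) * f k + c" "0 \<le> r" "r \<le> 1" "0 \<le> c"
  shows "f n \<le> (1 - r) ^ n * f 0 + real n * c"
proof (induction n)
  case (Suc n)
  have "f (Suc n) \<le> (1 - r) * f n + c" by (rule assms)
  also have "\<dots> \<le> (1 - r) * ((1 - r) ^ n * f 0 + real n * c) + c"
    using Suc assms by (intro add_right_mono mult_left_mono) auto
  also have "\<dots> \<le> (1 - r) * ((1 - r) ^ n * f 0) + real n * c + c"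
    using mult_right_mono[of "1 - r" 1 "real n * c"] assms by (simp add: distrib_left)
  finally show ?case by (simp add: algebra_simps)
qed simp

section \<open>Transfer of the state space norm to L^2\<close>

context bresse
begin

abbreviation N :: "state \<Rightarrow> real" where "N \<equiv> Hnorm L rho1 rho2 kap b k0 l"
abbreviation A :: "state \<Rightarrow> state" where "A \<equiv> Aop L rho1 rho2 kap b k0 l"

lemma sqint_T:
  assumes "U \<in> Hspace L"
  shows "sqint L (T U)"
proof -
  obtain \<phi> \<psi> w \<Phi> \<Psi> W where Ueq: "U = (\<phi>,\<psi>,w,\<Phi>,\<Psi>,W)" by (cases U)
  then have H: "H1 L \<phi>" "H1 L \<psi>" "H1 L w" "sqint L \<Phi>" "sqint L \<Psi>" "sqint L W"
    using assms by (auto simp: Hspace_def H1L_def L2_sqint)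
  note w = H(1-3)[THEN wd_wderiv]
  note sq = w[THEN wderiv_continuous, THEN continuous_sqint] w[THEN wderiv_sqint]
  have "sqint L (\<lambda>x. T (\<phi>,\<psi>,w,\<Phi>,\<Psi>,W) x)"
    unfolding T_def prod.case pack_def
    by (intro sqint_Pair sqint_scaleR sqint_add sqint_diff sqint_mult sq H)
  then show ?thesis by (simp add: Ueq)
qed

lemma nsq_pack:
  assumes "sqint L u" "sqint L \<Phi>" "sqint L v" "sqint L \<Psi>" "sqint L z" "sqint L W"
  shows "nsq L (\<lambda>x. pack (u x) (\<Phi> x) (v x) (\<Psi> x) (z x) (W x)) =
    kap * nsq L u + rho1 * nsq L \<Phi> + b * nsq L v + rho2 * nsq L \<Psi> + k0 * nsq L z + rho1 * nsq L W"
proof -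
  have i: "integrable (leb0 L) (\<lambda>x. (norm (f x))\<^sup>2)" if "sqint L f" for f :: cfun
    using that by (simp add: sqint_def)
  have "nsq L (\<lambda>x. pack (u x) (\<Phi> x) (v x) (\<Psi> x) (z x) (W x)) =
     (\<integral>x. kap * (norm (u x))\<^sup>2 + rho1 * (norm (\<Phi> x))\<^sup>2 + b * (norm (v x))\<^sup>2 + rho2 * (norm (\<Psi> x))\<^sup>2
     + k0 * (norm (z x))\<^sup>2 + rho1 * (norm (W x))\<^sup>2 \<partial>leb0 L)"
    unfolding nsq_def power2_norm_eq_inner inner_pack ..
  also have "\<dots> = kap * nsq L u + rho1 * nsq L \<Phi> + b * nsq L v + rho2 * nsq L \<Psi> + k0 * nsq L z + rho1 * nsq L W"
    using assms[THEN i] by (simp add: nsq_def)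
  finally show ?thesis .
qed

lemma N_sq:
  assumes "U \<in> Hspace L"
  shows "(N U)\<^sup>2 = nsq L (T U)"
proof -
  obtain \<phi> \<psi> w \<Phi> \<Psi> W where Ueq: "U = (\<phi>,\<psi>,w,\<Phi>,\<Psi>,W)" by (cases U)
  then have H: "H1 L \<phi>" "H1 L \<psi>" "H1 L w" "sqint L \<Phi>" "sqint L \<Psi>" "sqint L W"
    using assms by (auto simp: Hspace_def H1L_def L2_sqint)
  note w = H(1-3)[THEN wd_wderiv]
  note sq = w[THEN wderiv_continuous, THEN continuous_sqint] w[THEN wderiv_sqint]
  define u where "u = (\<lambda>x. wd L \<phi> x + \<psi> x + complex_of_real l * w x)"
  define v where "v = wd L \<psi>"
  define z where "z = (\<lambda>x. wd L w x - complex_of_real l * \<phi> x)"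
  have uvz: "sqint L u" "sqint L v" "sqint L z"
    unfolding u_def v_def z_def by (intro sqint_add sqint_diff sqint_mult sq)+
  have "T U = (\<lambda>x. pack (u x) (\<Phi> x) (v x) (\<Psi> x) (z x) (W x))"
    by (simp add: fun_eq_iff Ueq T_def u_def v_def z_def)
  then have *: "nsq L (T U) = kap * nsq L u + rho1 * nsq L \<Phi> + b * nsq L v + rho2 * nsq L \<Psi> + rho1 * nsq L W + k0 * nsq L z"
    using nsq_pack[OF uvz(1) H(4) uvz(2) H(5) uvz(3) H(6)] by simp
  have "0 \<le> nsq L (T U)" by (rule nsq_nonneg)
  then show ?thesis
    unfolding * unfolding Hnorm_def Ueq prod.case l2norm_nsq u_def[symmetric] v_def[symmetric] z_def[symmetric]
    by simp
qed

lemma N_nonneg: "U \<in> Hspace L \<Longrightarrow> N U \<ge> 0"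
proof -
  have "N U = sqrt r \<Longrightarrow> r \<ge> 0 \<Longrightarrow> N U \<ge> 0" for r by simp
  moreover obtain \<phi> \<psi> w \<Phi> \<Psi> W where Ueq: "U = (\<phi>,\<psi>,w,\<Phi>,\<Psi>,W)" by (cases U)
  ultimately show "N U \<ge> 0"
    using kap rho1 b rho2 k0 unfolding Ueq Hnorm_def prod.case l2norm_nsq
    by (intro real_sqrt_ge_zero add_nonneg_nonneg mult_nonneg_nonneg nsq_nonneg) auto
qed

lemma st_add_H: "U \<in> Hspace L \<Longrightarrow> V \<in> Hspace L \<Longrightarrow> st_add U V \<in> Hspace L"
  by (auto simp: Hspace_def st_add_def H1L_def H1_def L2_sqint intro: sqint_add wderiv_add)

lemma st_scale_H: "U \<in> Hspace L \<Longrightarrow> st_scale c U \<in> Hspace L"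
  by (auto simp: Hspace_def st_scale_def H1L_def H1_def L2_sqint intro: sqint_mult wderiv_cmult)

lemma st_sub_H: "U \<in> Hspace L \<Longrightarrow> V \<in> Hspace L \<Longrightarrow> st_sub U V \<in> Hspace L"
  unfolding st_sub_def by (intro st_add_H st_scale_H)

text \<open>Equality holds only almost everywhere, because \<open>wd\<close> of a combination is
  chosen independently of the \<open>wd\<close> of its parts.\<close>

lemma T_lin:
  assumes "U \<in> Hspace L" "V \<in> Hspace L"
  shows "AE x in leb0 L. T (st_add U (st_scale (complex_of_real c) V)) x = T U x + c *\<^sub>R T V x"
proof -
  obtain \<phi> \<psi> w \<Phi> \<Psi> W where Ueq: "U = (\<phi>,\<psi>,w,\<Phi>,\<Psi>,W)" by (cases U)
  obtain \<phi>2 \<psi>2 w2 \<Phi>2 \<Psi>2 W2 where Veq: "V = (\<phi>2,\<psi>2,w2,\<Phi>2,\<Psi>2,W2)" by (cases V)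
  from assms have H: "H1 L \<phi>" "H1 L \<psi>" "H1 L w" "H1 L \<phi>2" "H1 L \<psi>2" "H1 L w2"
    by (auto simp: Ueq Veq Hspace_def H1L_def)
  note w = H[THEN wd_wderiv]
  let ?c = "complex_of_real c"
  have lin: "is_wderiv L (\<lambda>x. f x + ?c * g x) (\<lambda>x. wd L f x + ?c * wd L g x)" if "is_wderiv L f (wd L f)" "is_wderiv L g (wd L g)" for f g
    by (intro wderiv_add wderiv_cmult that)
  show ?thesis
    using T_AE[OF lin[OF w(1) w(4)] lin[OF w(2) w(5)] lin[OF w(3) w(6)], of "\<lambda>x. \<Phi> x + ?c * \<Phi>2 x" "\<lambda>x. \<Psi> x + ?c * \<Psi>2 x" "\<lambda>x. W x + ?c * W2 x"]
    unfolding Ueq Veq st_add_def st_scale_def prod.case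
  proof eventually_elim
    case (elim x)
    show ?case unfolding elim unfolding T_def prod.case pack_add
      by (simp add: scaleR_conv_of_real algebra_simps)
  qed
qed

lemma T_sub:
  assumes "U \<in> Hspace L" "V \<in> Hspace L"
  shows "AE x in leb0 L. T (st_sub U V) x = T U x - T V x"
  using T_lin[OF assms, of "-1"] by (simp add: st_sub_def)

lemma T_scale:
  assumes "U \<in> Hspace L"
  shows "AE x in leb0 L. T (st_scale (complex_of_real c) U) x = c *\<^sub>R T U x"
proof -
  \<comment> \<open>A multiple of \<open>U\<close> is written as \<open>U + (c - 1) U\<close>, the
    shape covered by \<open>T_lin\<close>.\<close>
  have "st_scale (complex_of_real c) U = st_add U (st_scale (complex_of_real (c - 1)) U)"
    by (cases U) (simp add: st_scale_def st_add_def algebra_simps)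
  moreover have "AE x in leb0 L. T (st_add U (st_scale (complex_of_real (c - 1)) U)) x = T U x + (c - 1) *\<^sub>R T U x"
    by (rule T_lin[OF assms assms])
  moreover have "y + (c - 1) *\<^sub>R y = c *\<^sub>R y" for y :: cx6
    by (simp add: scaleR_left_diff_distrib)
  ultimately show ?thesis by simp
qed

lemma N_sub_sq:
  assumes "U \<in> Hspace L" "V \<in> Hspace L"
  shows "(N (st_sub U V))\<^sup>2 = nsq L (\<lambda>x. T U x - T V x)"
  unfolding N_sq[OF st_sub_H[OF assms]]
  by (rule nsq_cong_AE[OF T_sub[OF assms]]) (intro sqint_diff sqint_T st_sub_H assms)+

lemma N_sub_0:
  assumes "U \<in> Hspace L" "V \<in> Hspace L" "N (st_sub U V) = 0"
  shows "AE x in leb0 L. T U x = T V x"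
proof -
  have "nsq L (\<lambda>x. T U x - T V x) = 0" using N_sub_sq[OF assms(1,2)] assms(3) by simp
  from nsq_eq_0[OF sqint_diff[OF sqint_T[OF assms(1)] sqint_T[OF assms(2)]] this] show ?thesis by simp
qed

text \<open>Difference quotient minus its candidate limit: the defect whose norm tends to 0 in
  \<open>has_generator\<close>.\<close>

definition quot :: "real \<Rightarrow> state \<Rightarrow> state \<Rightarrow> state \<Rightarrow> state" where
  "quot h X Y Z = st_sub (st_scale (complex_of_real (1 / h)) (st_sub X Y)) Z"

lemma quot_H: "X \<in> Hspace L \<Longrightarrow> Y \<in> Hspace L \<Longrightarrow> Z \<in> Hspace L \<Longrightarrow> quot h X Y Z \<in> Hspace L"
  unfolding quot_def by (intro st_sub_H st_scale_H)

lemma T_quot: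
  assumes "X \<in> Hspace L" "Y \<in> Hspace L" "Z \<in> Hspace L"
  shows "AE x in leb0 L. T (quot h X Y Z) x = (1/h) *\<^sub>R (T X x - T Y x) - T Z x"
  unfolding quot_def
  using T_sub[OF st_scale_H[OF st_sub_H[OF assms(1,2)], of "complex_of_real (1/h)"] assms(3)]
    T_scale[OF st_sub_H[OF assms(1,2)], of "1/h"] T_sub[OF assms(1,2)]
  by eventually_elim simp


section \<open>Equivalence with the energy, and a single time step\<close>

lemma inner_J_bound: "\<bar>inner y (J y')\<bar> \<le> onorm J * (norm y * norm y')"
proof -
  have "\<bar>inner y (J y')\<bar> \<le> norm y * norm (J y')" by (rule Cauchy_Schwarz_ineq2)
  also have "\<dots> \<le> norm y * (onorm J * norm y')"
    by (intro mult_left_mono onorm[OF bounded_linear_J]) simp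
  finally show ?thesis by (simp add: algebra_simps)
qed

text \<open>The second bound keeps the multiplier term below half the product of the norms, which
  makes the functional equivalent to the energy; \<open>onorm J + 1\<close> keeps the denominator
  positive.\<close>

definition eps :: real where "eps = min eps0 (1 / (2 * exp (C0 * L) * (onorm J + 1)))"

lemma eps: "eps > 0" "eps \<le> eps0" "eps * exp (C0 * L) * onorm J \<le> 1/2"
proof -
  have J0: "onorm J \<ge> 0" by (rule onorm_pos_le[OF bounded_linear_J])
  then show "eps > 0" "eps \<le> eps0" using eps0_pos by (auto simp: eps_def add_nonneg_pos)
  have "eps * (2 * exp (C0 * L) * (onorm J + 1)) \<le> 1"
    using J0 by (simp add: eps_def pos_le_divide_eq[symmetric] add_nonneg_pos)
  moreover have "eps * (2 * exp (C0 * L) * onorm J) \<le> eps * (2 * exp (C0 * L) * (onorm J + 1))"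
    using \<open>eps > 0\<close> by simp
  moreover have "eps * (2 * exp (C0 * L) * onorm J) = 2 * (eps * exp (C0 * L) * onorm J)" by simp
  ultimately show "eps * exp (C0 * L) * onorm J \<le> 1/2" by linarith
qed

lemma form_perturbation:
  assumes "x \<in> {0..L}"
  shows "\<bar>eps * m x * inner y (J y')\<bar> \<le> 1/2 * (norm y * norm y')"
proof -
  have J0: "onorm J \<ge> 0" by (rule onorm_pos_le[OF bounded_linear_J])
  have "\<bar>eps * m x * inner y (J y')\<bar> = eps * \<bar>m x\<bar> * \<bar>inner y (J y')\<bar>"
    using eps(1) by (simp add: abs_mult)
  also have "\<dots> \<le> eps * exp (C0 * L) * (onorm J * (norm y * norm y'))"
    using eps(1) m_bounds(2)[OF assms] inner_J_bound by (intro mult_mono) auto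
  also have "\<dots> = (eps * exp (C0 * L) * onorm J) * (norm y * norm y')" by simp
  also have "\<dots> \<le> 1/2 * (norm y * norm y')" using eps(3) by (rule mult_right_mono) simp
  finally show ?thesis .
qed

lemma form_le:
  assumes "x \<in> {0..L}"
  shows "\<bar>form eps x y y'\<bar> \<le> 2 * (norm y * norm y')"
proof -
  have "\<bar>inner y y'\<bar> \<le> norm y * norm y'" by (rule Cauchy_Schwarz_ineq2)
  moreover have "0 \<le> norm y * norm y'" by simp
  ultimately show ?thesis using form_perturbation[OF assms, of y y'] unfolding form_def by linarith
qed

lemma form_ge:
  assumes "x \<in> {0..L}"
  shows "(norm y)\<^sup>2 \<le> 2 * form eps x y y"
proof -
  have "\<bar>eps * m x * inner y (J y)\<bar> \<le> 1/2 * (norm y)\<^sup>2"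
    using form_perturbation[OF assms, of y y] by (simp add: power2_eq_square)
  moreover have "Y \<le> 2 * (Y + t)" if "\<bar>t\<bar> \<le> 1/2 * Y" for t Y :: real
    using that by (simp add: abs_le_iff)
  ultimately show ?thesis unfolding form_def power2_norm_eq_inner by blast
qed

lemma form_add_scale:
  "form eps x (y + h *\<^sub>R z) (y + h *\<^sub>R z) = form eps x y y + 2 * h * form eps x y z + h\<^sup>2 * form eps x z z"
proof -
  have lin: "linear J" by (rule bounded_linear.linear[OF bounded_linear_J])
  show ?thesis
    unfolding form_def linear_add[OF lin] linear_cmul[OF lin] inner_add_left inner_add_right inner_scaleR_left inner_scaleR_right
    by (simp add: J_symmetric[of z y] inner_commute[of z y] algebra_simps power2_eq_square)
qed

text \<open>In use, y is the current state, a the generator applied to it and k the defect of the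
  difference quotient over time h. The cross term of y and k is only linear in k, so it is split by
  Young's inequality with a free parameter d; the share \<open>d |y|^2\<close> will be paid by the
  dissipation.\<close>

lemma form_step:
  assumes x: "x \<in> {0..L}" and h: "h > 0" and d: "d > 0"
  shows "form eps x (y + h *\<^sub>R (a + k)) (y + h *\<^sub>R (a + k)) \<le> form eps x y y + 2 * h * form eps x y a
     + h * (d * (norm y)\<^sup>2 + 4/d * (norm k)\<^sup>2) + 4 * h\<^sup>2 * ((norm a)\<^sup>2 + (norm k)\<^sup>2)"
proof -
  have fa: "form eps x y (a + k) = form eps x y a + form eps x y k"
    unfolding form_def linear_add[OF bounded_linear.linear[OF bounded_linear_J]] inner_add_right
    by (simp add: algebra_simps)
  have "2 * form eps x y k \<le> 4 * (norm y * norm k)" using form_le[OF x, of y k] by linarith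
  also have "\<dots> \<le> d * (norm y)\<^sup>2 + 4/d * (norm k)\<^sup>2"
  proof -
    have "0 \<le> (d * norm y - 2 * norm k)\<^sup>2 / d" using d by simp
    also have "\<dots> = d * (norm y)\<^sup>2 + 4/d * (norm k)\<^sup>2 - 4 * (norm y * norm k)"
      using d by (simp add: power2_eq_square field_simps)
    finally show ?thesis by simp
  qed
  finally have 1: "h * (2 * form eps x y k) \<le> h * (d * (norm y)\<^sup>2 + 4/d * (norm k)\<^sup>2)"
    using h by simp
  have "form eps x (a + k) (a + k) \<le> 2 * (norm (a + k))\<^sup>2"
    using form_le[OF x, of "a + k" "a + k"] by (simp add: power2_eq_square)
  also have "(norm (a + k))\<^sup>2 \<le> (norm a + norm k)\<^sup>2" by (intro power_mono norm_triangle_ineq) simp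
  also have "(norm a + norm k)\<^sup>2 \<le> 2 * ((norm a)\<^sup>2 + (norm k)\<^sup>2)"
    using sum_squares_bound[of "norm a" "norm k"] by (simp add: power2_sum)
  finally have "form eps x (a + k) (a + k) \<le> 4 * ((norm a)\<^sup>2 + (norm k)\<^sup>2)" by simp
  then have "h\<^sup>2 * form eps x (a + k) (a + k) \<le> h\<^sup>2 * (4 * ((norm a)\<^sup>2 + (norm k)\<^sup>2))"
    by (rule mult_left_mono) simp
  then show ?thesis unfolding form_add_scale fa using 1 by (simp add: algebra_simps)
qed

lemma integrable_form:
  assumes "sqint L f" "sqint L g"
  shows "integrable (leb0 L) (\<lambda>x. form eps x (f x) (g x))"
proof -
  note [measurable] = assms[THEN sqint_measurable]
  have "J \<in> borel_measurable borel"
    by (intro borel_measurable_continuous_onI linear_continuous_on bounded_linear_J)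
  note [measurable] = this
  have "m \<in> borel_measurable (leb0 L)"
    unfolding m_def[abs_def] by (intro continuous_leb0_measurable continuous_intros)
  note [measurable] = this
  have "integrable (leb0 L) (\<lambda>x. 2 * (norm (f x))\<^sup>2 + 2 * (norm (g x))\<^sup>2)" using assms by (simp add: sqint_def)
  then show ?thesis
  proof (rule Bochner_Integration.integrable_bound)
    show "AE x in leb0 L. norm (form eps x (f x) (g x)) \<le> norm (2 * (norm (f x))\<^sup>2 + 2 * (norm (g x))\<^sup>2)"
    proof (rule AE_I2)
      fix x assume "x \<in> space (leb0 L)"
      then have "\<bar>form eps x (f x) (g x)\<bar> \<le> 2 * (norm (f x) * norm (g x))"
        by (intro form_le) (simp add: space_restrict_space)
      also have "\<dots> \<le> (norm (f x))\<^sup>2 + (norm (g x))\<^sup>2"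
        using sum_squares_bound[of "norm (f x)" "norm (g x)"] by simp
      also have "\<dots> \<le> 2 * (norm (f x))\<^sup>2 + 2 * (norm (g x))\<^sup>2" by simp
      finally show "norm (form eps x (f x) (g x)) \<le> norm (2 * (norm (f x))\<^sup>2 + 2 * (norm (g x))\<^sup>2)" by simp
    qed
    show "(\<lambda>x. form eps x (f x) (g x)) \<in> borel_measurable (leb0 L)" unfolding form_def by measurable
  qed
qed

definition lyap :: "(real \<Rightarrow> cx6) \<Rightarrow> real" where
  "lyap f = (\<integral>x. form eps x (f x) (f x) \<partial>leb0 L)"

lemma lyap_bounds:
  assumes "sqint L f"
  shows "nsq L f \<le> 2 * lyap f" "lyap f \<le> 2 * nsq L f"
proof -
  have i: "integrable (leb0 L) (\<lambda>x. (norm (f x))\<^sup>2)" using assms by (simp add: sqint_def)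
  note j = integrable_form[OF assms assms]
  have "nsq L f \<le> (\<integral>x. 2 * form eps x (f x) (f x) \<partial>leb0 L)" unfolding nsq_def
    by (rule Bochner_Integration.integral_mono) (use i j form_ge in \<open>auto simp: space_restrict_space\<close>)
  then show "nsq L f \<le> 2 * lyap f" by (simp add: lyap_def)
  have "lyap f \<le> (\<integral>x. 2 * (norm (f x))\<^sup>2 \<partial>leb0 L)" unfolding lyap_def
  proof (rule Bochner_Integration.integral_mono)
    fix x assume "x \<in> space (leb0 L)"
    then have "\<bar>form eps x (f x) (f x)\<bar> \<le> 2 * (norm (f x) * norm (f x))"
      by (intro form_le) (simp add: space_restrict_space)
    then show "form eps x (f x) (f x) \<le> 2 * (norm (f x))\<^sup>2" by (simp add: power2_eq_square)
  qed (use i j in auto)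
  then show "lyap f \<le> 2 * nsq L f" by (simp add: nsq_def)
qed

lemma lyap_cong_AE:
  assumes "AE x in leb0 L. f x = g x" "sqint L f" "sqint L g"
  shows "lyap f = lyap g"
  unfolding lyap_def
  by (rule Bochner_Integration.integral_cong_AE)
     (use assms(1) integrable_form[OF assms(2,2)] integrable_form[OF assms(3,3)] in \<open>auto dest: borel_measurable_integrable\<close>)

text \<open>The dissipation \<open>eps * C0\<close> is spent in four shares of \<open>rate\<close>:
  two pay the Young error with parameter \<open>2 * rate\<close>, the other two dominate
  \<open>rate\<close> times the functional, which is at most twice the squared norm.\<close>

definition rate :: real where "rate = eps * C0 / 4"

lemma rate_pos: "rate > 0"
  using eps(1) C0_pos by (simp add: rate_def)

text \<open>An explicit Euler estimate: z is \<open>y + h (A U + k)\<close> almost everywhere. Only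
  almost-everywhere agreement of y with \<open>T U\<close> is asked for, because a state on an orbit
  merely has a representative in the domain.\<close>

lemma lyap_step:
  assumes U: "U \<in> DA L kap b k0 l g1 g2 g3" "U \<in> Hspace L" "A U \<in> Hspace L" and h: "h > 0"
    and y: "sqint L y" "AE x in leb0 L. y x = T U x" and z: "sqint L z"
    and k: "sqint L k" "AE x in leb0 L. k x = (1/h) *\<^sub>R (z x - y x) - T (A U) x"
  shows "lyap z \<le> (1 - rate * h) * lyap y + h * (4 / (2 * rate) * nsq L k + 4 * h * (nsq L (T (A U)) + nsq L k))"
proof -
  let ?a = "T (A U)"
  have sq: "sqint L (T U)" "sqint L ?a" using U sqint_T by auto
  have d: "2 * rate > 0" using rate_pos by simp
  have I: "integrable (leb0 L) (\<lambda>x. (norm (T U x))\<^sup>2)" "integrable (leb0 L) (\<lambda>x. (norm (k x))\<^sup>2)" "integrable (leb0 L) (\<lambda>x. (norm (?a x))\<^sup>2)"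
    using sq k by (auto simp: sqint_def)
  have sp: "AE x in leb0 L. x \<in> {0..L}" unfolding AE_leb0 by simp
  have "lyap z \<le> (\<integral>x. form eps x (T U x) (T U x) + 2 * h * form eps x (T U x) (?a x)
     + h * (2 * rate * (norm (T U x))\<^sup>2 + 4/(2 * rate) * (norm (k x))\<^sup>2) + 4 * h\<^sup>2 * ((norm (?a x))\<^sup>2 + (norm (k x))\<^sup>2) \<partial>leb0 L)"
    unfolding lyap_def
  proof (rule integral_mono_AE)
    show "AE x in leb0 L. form eps x (z x) (z x) \<le> form eps x (T U x) (T U x) + 2 * h * form eps x (T U x) (?a x)
     + h * (2 * rate * (norm (T U x))\<^sup>2 + 4/(2 * rate) * (norm (k x))\<^sup>2) + 4 * h\<^sup>2 * ((norm (?a x))\<^sup>2 + (norm (k x))\<^sup>2)"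
      using sp y(2) k(2)
    proof eventually_elim
      case (elim x)
      have "z x = T U x + h *\<^sub>R (?a x + k x)" using elim h by (simp add: scaleR_diff_right scaleR_add_right)
      then show ?case using form_step[OF elim(1) h d] by simp
    qed
  qed (use I integrable_form z sq in auto)
  also have "\<dots> = lyap (T U) + h * (2 * (\<integral>x. form eps x (T U x) (?a x) \<partial>leb0 L))
     + h * (2 * rate * nsq L (T U) + 4/(2 * rate) * nsq L k) + 4 * h\<^sup>2 * (nsq L ?a + nsq L k)"
    using I integrable_form[OF sq(1) sq(1)] integrable_form[OF sq(1) sq(2)] by (simp add: lyap_def nsq_def)
  also have "2 * (\<integral>x. form eps x (T U x) (?a x) \<partial>leb0 L) \<le> - eps * C0 * nsq L (T U)"
    unfolding nsq_def
    by (rule lyapunov_static[OF U(1) less_imp_le[OF eps(1)] eps(2) integrable_form[OF sq] I(1)])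
  finally have "lyap z \<le> lyap (T U) + h * (- eps * C0 * nsq L (T U))
     + h * (2 * rate * nsq L (T U) + 4/(2 * rate) * nsq L k) + 4 * h\<^sup>2 * (nsq L ?a + nsq L k)"
    using h by simp
  moreover have "rate * h * lyap (T U) \<le> rate * h * (2 * nsq L (T U))"
    using lyap_bounds(2)[OF sq(1)] rate_pos h by (intro mult_left_mono) auto
  moreover have "h * (- eps * C0 * nsq L (T U)) = - (4 * (rate * h * nsq L (T U)))" by (simp add: rate_def)
  moreover have "h * (2 * rate * nsq L (T U) + 4/(2 * rate) * nsq L k) = 2 * (rate * h * nsq L (T U)) + h * (4/(2 * rate) * nsq L k)"
    by (simp add: distrib_left)
  moreover have "rate * h * (2 * nsq L (T U)) = 2 * (rate * h * nsq L (T U))" by simp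
  moreover have "(1 - rate * h) * lyap (T U) + h * (4 / (2 * rate) * nsq L k + 4 * h * (nsq L ?a + nsq L k))
     = lyap (T U) - rate * h * lyap (T U) + h * (4 / (2 * rate) * nsq L k) + 4 * h\<^sup>2 * (nsq L ?a + nsq L k)"
    by (simp add: distrib_left left_diff_distrib power2_eq_square)
  ultimately have "lyap z \<le> (1 - rate * h) * lyap (T U) + h * (4 / (2 * rate) * nsq L k + 4 * h * (nsq L ?a + nsq L k))"
    by linarith
  moreover have "lyap y = lyap (T U)" by (rule lyap_cong_AE[OF y(2,1) sq(1)])
  ultimately show ?thesis by simp
qed

end

section \<open>Decay along the semigroup\<close>

locale bresse_semigroup = bresse +
  fixes S :: "real \<Rightarrow> state \<Rightarrow> state"
  assumes S: "C0_contraction_semigroup (Hspace L) (Hnorm L rho1 rho2 kap b k0 l) S"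
    and gen: "has_generator (Hspace L) (Hnorm L rho1 rho2 kap b k0 l) S
           (DA L kap b k0 l g1 g2 g3) (Aop L rho1 rho2 kap b k0 l)"
begin

abbreviation D :: "state set" where "D \<equiv> DA L kap b k0 l g1 g2 g3"

lemma S_H: "t \<ge> 0 \<Longrightarrow> U \<in> Hspace L \<Longrightarrow> S t U \<in> Hspace L"
  using S unfolding C0_contraction_semigroup_def by blast

lemma S_contr: "t \<ge> 0 \<Longrightarrow> U \<in> Hspace L \<Longrightarrow> N (S t U) \<le> N U"
  using S unfolding C0_contraction_semigroup_def by blast

lemma S_nsq:
  assumes "t \<ge> 0" "U \<in> Hspace L"
  shows "nsq L (T (S t U)) \<le> nsq L (T U)"
  unfolding N_sq[OF S_H[OF assms], symmetric] N_sq[OF assms(2), symmetric]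
  by (intro power_mono S_contr N_nonneg S_H assms)

lemma S_lin:
  assumes t: "t \<ge> 0" and UV: "U \<in> Hspace L" "V \<in> Hspace L"
  shows "AE x in leb0 L. T (S t (st_add U (st_scale (complex_of_real c) V))) x = T (S t U) x + c *\<^sub>R T (S t V) x"
proof -
  have "N (st_sub (S t (st_add U (st_scale (complex_of_real c) V))) (st_add (S t U) (st_scale (complex_of_real c) (S t V)))) = 0"
    using S t UV unfolding C0_contraction_semigroup_def by blast
  from N_sub_0[OF _ _ this] have "AE x in leb0 L. T (S t (st_add U (st_scale (complex_of_real c) V))) x
     = T (st_add (S t U) (st_scale (complex_of_real c) (S t V))) x"
    by (simp add: st_add_H st_scale_H S_H t UV)
  then show ?thesis using T_lin[OF S_H[OF t UV(1)] S_H[OF t UV(2)], of c] by eventually_elim simp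
qed

lemma S_sub:
  assumes t: "t \<ge> 0" and UV: "U \<in> Hspace L" "V \<in> Hspace L"
  shows "AE x in leb0 L. T (S t (st_sub U V)) x = T (S t U) x - T (S t V) x"
  using S_lin[OF assms, of "-1"] by (simp add: st_sub_def)

lemma S_scale:
  assumes t: "t \<ge> 0" and U: "U \<in> Hspace L"
  shows "AE x in leb0 L. T (S t (st_scale (complex_of_real c) U)) x = c *\<^sub>R T (S t U) x"
proof -
  \<comment> \<open>The linearity axiom of the semigroup is phrased for combinations
    \<open>U + c V\<close>, hence the same rewriting as for \<open>T_scale\<close>.\<close>
  have "st_scale (complex_of_real c) U = st_add U (st_scale (complex_of_real (c - 1)) U)"
    by (cases U) (simp add: st_scale_def st_add_def algebra_simps)
  moreover have "AE x in leb0 L. T (S t (st_add U (st_scale (complex_of_real (c - 1)) U))) x = T (S t U) x + (c - 1) *\<^sub>R T (S t U) x"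
    by (rule S_lin[OF t U U])
  moreover have "y + (c - 1) *\<^sub>R y = c *\<^sub>R y" for y :: cx6
    by (simp add: scaleR_left_diff_distrib)
  ultimately show ?thesis by simp
qed

lemma S_quot:
  assumes t: "t \<ge> 0" and H: "X \<in> Hspace L" "Y \<in> Hspace L" "Z \<in> Hspace L"
  shows "AE x in leb0 L. T (S t (quot h X Y Z)) x = (1/h) *\<^sub>R (T (S t X) x - T (S t Y) x) - T (S t Z) x"
  unfolding quot_def
  using S_sub[OF t st_scale_H[OF st_sub_H[OF H(1,2)], of "complex_of_real (1/h)"] H(3)]
    S_scale[OF t st_sub_H[OF H(1,2)], of "1/h"] S_sub[OF t H(1,2)]
  by eventually_elim simp

lemma S_semi:
  assumes "t \<ge> 0" "s \<ge> 0" "U \<in> Hspace L"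
  shows "AE x in leb0 L. T (S (t + s) U) x = T (S t (S s U)) x"
proof (rule N_sub_0)
  show "N (st_sub (S (t + s) U) (S t (S s U))) = 0"
    using S assms unfolding C0_contraction_semigroup_def by blast
qed (use assms S_H in auto)

lemma S_zero:
  assumes "U \<in> Hspace L"
  shows "AE x in leb0 L. T (S 0 U) x = T U x"
proof (rule N_sub_0)
  show "N (st_sub (S 0 U) U) = 0"
    using S assms unfolding C0_contraction_semigroup_def by blast
qed (use assms S_H in auto)

lemma D_H: "U \<in> D \<Longrightarrow> U \<in> Hspace L" and A_H: "U \<in> D \<Longrightarrow> A U \<in> Hspace L"
  using gen unfolding has_generator_def by blast+

text \<open>The convergence of the difference quotients along an orbit is uniform in time, because
  \<open>S t\<close> is a contraction that commutes with the difference quotient.\<close>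
lemma quot_orbit:
  assumes U: "U \<in> D" and t: "t \<ge> 0" and h: "h \<ge> 0"
  shows "nsq L (\<lambda>x. (1/h) *\<^sub>R (T (S (t + h) U) x - T (S t U) x) - T (S t (A U)) x) \<le> (N (quot h (S h U) U (A U)))\<^sup>2"
    and "nsq L (\<lambda>x. (1/h) *\<^sub>R (T (S h (S t U)) x - T (S t U) x) - T (S t (A U)) x) \<le> (N (quot h (S h U) U (A U)))\<^sup>2"
proof -
  note H = D_H[OF U] A_H[OF U]
  note H' = S_H[OF h H(1)]
  have q: "quot h (S h U) U (A U) \<in> Hspace L" by (intro quot_H H H')
  have sq: "sqint L (T (S t (quot h (S h U) U (A U))))" by (intro sqint_T S_H t q)
  have sq': "sqint L (\<lambda>x. (1/h) *\<^sub>R (T X x - T (S t U) x) - T (S t (A U)) x)" if "X \<in> Hspace L" for X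
    by (intro sqint_diff sqint_scaleR sqint_T S_H t H that)
  have le: "nsq L (T (S t (quot h (S h U) U (A U)))) \<le> (N (quot h (S h U) U (A U)))\<^sup>2"
    using S_nsq[OF t q] N_sq[OF q] by simp
  have th: "t + h \<ge> 0" using t h by simp
  have 1: "AE x in leb0 L. (1/h) *\<^sub>R (T (S (t + h) U) x - T (S t U) x) - T (S t (A U)) x = T (S t (quot h (S h U) U (A U))) x"
    using S_quot[OF t H' H, of h] S_semi[OF t h H(1)] by eventually_elim simp
  show "nsq L (\<lambda>x. (1/h) *\<^sub>R (T (S (t + h) U) x - T (S t U) x) - T (S t (A U)) x) \<le> (N (quot h (S h U) U (A U)))\<^sup>2"
    unfolding nsq_cong_AE[OF 1 sq'[OF S_H[OF th H(1)]] sq] by (rule le)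
  \<comment> \<open>\<open>S h (S t U)\<close> and \<open>S t (S h U)\<close> agree through
    \<open>S (t + h) U\<close>. This version, with a quotient taken at the state
    \<open>S t U\<close>, is the one that tests the generator there.\<close>
  have 2: "AE x in leb0 L. (1/h) *\<^sub>R (T (S h (S t U)) x - T (S t U) x) - T (S t (A U)) x = T (S t (quot h (S h U) U (A U))) x"
    using S_quot[OF t H' H, of h] S_semi[OF t h H(1)] S_semi[OF h t H(1)] by eventually_elim (simp add: add.commute)
  show "nsq L (\<lambda>x. (1/h) *\<^sub>R (T (S h (S t U)) x - T (S t U) x) - T (S t (A U)) x) \<le> (N (quot h (S h U) U (A U)))\<^sup>2"
    unfolding nsq_cong_AE[OF 2 sq'[OF S_H[OF h S_H[OF t H(1)]]] sq] by (rule le)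
qed

lemma quot_tendsto: "U \<in> D \<Longrightarrow> ((\<lambda>h. N (quot h (S h U) U (A U))) \<longlongrightarrow> 0) (at_right 0)"
  using gen unfolding has_generator_def quot_def by blast

text \<open>The quotients at \<open>S t U\<close>, with candidate limit \<open>S t (A U)\<close>,
  have a defect no larger than those at \<open>U\<close>, so the last clause of
  \<open>has_generator\<close> applies. The domain element it yields represents \<open>S t U\<close>
  only up to null sets, hence the almost-everywhere conclusions.\<close>

lemma orbit_in_D:
  assumes U: "U \<in> D" and t: "t \<ge> 0"
  obtains U' where "U' \<in> D" "AE x in leb0 L. T (S t U) x = T U' x" "AE x in leb0 L. T (A U') x = T (S t (A U)) x"
proof -
  note H = D_H[OF U] A_H[OF U]
  note H' = S_H[OF t H(1)] S_H[OF t H(2)]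
  have "((\<lambda>h. N (quot h (S h (S t U)) (S t U) (S t (A U)))) \<longlongrightarrow> 0) (at_right 0)"
  proof (rule tendsto_sandwich[OF _ _ tendsto_const quot_tendsto[OF U]])
    have pos: "\<forall>\<^sub>F h in at_right (0::real). h > 0" by (rule eventually_at_right_less)
    show "\<forall>\<^sub>F h in at_right 0. 0 \<le> N (quot h (S h (S t U)) (S t U) (S t (A U)))"
      using pos by eventually_elim (intro N_nonneg quot_H S_H H' H t; simp)
    show "\<forall>\<^sub>F h in at_right 0. N (quot h (S h (S t U)) (S t U) (S t (A U))) \<le> N (quot h (S h U) U (A U))"
      using pos
    proof eventually_elim
      case (elim h)
      then have h: "h \<ge> 0" by simp
      have q: "quot h (S h (S t U)) (S t U) (S t (A U)) \<in> Hspace L" by (intro quot_H S_H H' h)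
      have "(N (quot h (S h (S t U)) (S t U) (S t (A U))))\<^sup>2
        = nsq L (\<lambda>x. (1/h) *\<^sub>R (T (S h (S t U)) x - T (S t U) x) - T (S t (A U)) x)"
        unfolding N_sq[OF q]
        by (rule nsq_cong_AE[OF T_quot[OF S_H[OF h H'(1)] H']])
           (intro sqint_T q sqint_diff sqint_scaleR S_H H' h)+
      also have "\<dots> \<le> (N (quot h (S h U) U (A U)))\<^sup>2" by (rule quot_orbit(2)[OF U t h])
      finally show ?case
        by (rule power2_le_imp_le) (intro N_nonneg quot_H S_H H h)
    qed
  qed
  then obtain U' where U': "U' \<in> D" "N (st_sub (S t U) U') = 0" "N (st_sub (A U') (S t (A U))) = 0"
    using gen H' unfolding has_generator_def quot_def by blast
  show ?thesis
    by (rule that[OF U'(1) N_sub_0[OF H'(1) D_H[OF U'(1)] U'(2)] N_sub_0[OF A_H[OF U'(1)] H'(2) U'(3)]])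
qed

text \<open>The error term does not depend on t: the defect along the orbit is bounded by the one at
  time 0, and \<open>A U'\<close> has the norm of \<open>S t (A U)\<close>, at most that of
  \<open>A U\<close>. This uniformity is what permits iteration.\<close>

lemma decay_step:
  assumes U: "U \<in> D" and t: "t \<ge> 0" and h: "h > 0"
  defines "\<eta> \<equiv> (N (quot h (S h U) U (A U)))\<^sup>2"
  shows "lyap (T (S (t + h) U)) \<le> (1 - rate * h) * lyap (T (S t U))
     + h * (4 / (2 * rate) * \<eta> + 4 * h * ((N (A U))\<^sup>2 + \<eta>))"
proof -
  note H = D_H[OF U] A_H[OF U]
  obtain U' where U': "U' \<in> D" and TU': "AE x in leb0 L. T (S t U) x = T U' x"
    and TA: "AE x in leb0 L. T (A U') x = T (S t (A U)) x"
    using orbit_in_D[OF U t] .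
  note H' = D_H[OF U'] A_H[OF U']
  have th: "t + h \<ge> 0" using t h by simp
  let ?k = "\<lambda>x. (1/h) *\<^sub>R (T (S (t + h) U) x - T (S t U) x) - T (S t (A U)) x"
  have sk: "sqint L ?k" by (intro sqint_diff sqint_scaleR sqint_T S_H t th H)
  have kae: "AE x in leb0 L. ?k x = (1/h) *\<^sub>R (T (S (t + h) U) x - T (S t U) x) - T (A U') x"
    using TA by eventually_elim simp
  have "lyap (T (S (t + h) U)) \<le> (1 - rate * h) * lyap (T (S t U))
     + h * (4 / (2 * rate) * nsq L ?k + 4 * h * (nsq L (T (A U')) + nsq L ?k))"
    by (rule lyap_step[OF U' H' h sqint_T[OF S_H[OF t H(1)]] TU' sqint_T[OF S_H[OF th H(1)]] sk kae])
  also have "\<dots> \<le> (1 - rate * h) * lyap (T (S t U)) + h * (4 / (2 * rate) * \<eta> + 4 * h * ((N (A U))\<^sup>2 + \<eta>))"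
  proof -
    have k: "nsq L ?k \<le> \<eta>" unfolding \<eta>_def by (rule quot_orbit(1)[OF U t less_imp_le[OF h]])
    have "nsq L (T (A U')) = nsq L (T (S t (A U)))"
      by (rule nsq_cong_AE[OF TA]) (intro sqint_T S_H t H H')+
    also have "\<dots> \<le> (N (A U))\<^sup>2" using S_nsq[OF t H(2)] N_sq[OF H(2)] by simp
    finally have a: "nsq L (T (A U')) \<le> (N (A U))\<^sup>2" .
    show ?thesis
      using h rate_pos k a by (intro add_left_mono mult_left_mono add_mono) auto
  qed
  finally show ?thesis .
qed

text \<open>With \<open>Suc n\<close> steps of length \<open>h = t / Suc n\<close> the contraction
  factors multiply to at most \<open>exp (- rate * t)\<close>, while the errors
  \<open>h * ?e h\<close> add up to \<open>t * ?e h\<close>, which vanishes as h tends to 0.\<close>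

lemma decay_D:
  assumes U: "U \<in> D" and t: "t > 0"
  shows "lyap (T (S t U)) \<le> exp (- rate * t) * lyap (T U)"
proof -
  note H = D_H[OF U] A_H[OF U]
  let ?\<eta> = "\<lambda>h. (N (quot h (S h U) U (A U)))\<^sup>2"
  let ?e = "\<lambda>h. 4 / (2 * rate) * ?\<eta> h + 4 * h * ((N (A U))\<^sup>2 + ?\<eta> h)"
  have "(?e \<longlongrightarrow> 4 / (2 * rate) * 0\<^sup>2 + 4 * 0 * ((N (A U))\<^sup>2 + 0\<^sup>2)) (at_right 0)"
    by (intro tendsto_intros quot_tendsto[OF U])
  then have e0: "(?e \<longlongrightarrow> 0) (at_right 0)" by simp
  let ?h = "\<lambda>n. t / real (Suc n)"
  have "filterlim ?h (at_right 0) sequentially"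
  proof (rule tendsto_imp_filterlim_at_right)
    show "?h \<longlonglongrightarrow> 0" by (rule LIMSEQ_Suc) (rule lim_const_over_n)
  qed (use t in auto)
  from filterlim_compose[OF e0 this] have lim0: "(\<lambda>n. t * ?e (?h n)) \<longlonglongrightarrow> t * 0"
    by (intro tendsto_intros)
  then have lim: "(\<lambda>n. exp (- rate * t) * lyap (T U) + t * ?e (?h n)) \<longlonglongrightarrow> exp (- rate * t) * lyap (T U) + t * 0"
    by (intro tendsto_add tendsto_const lim0)
  have l0: "0 \<le> lyap (T U)" using lyap_bounds(1)[OF sqint_T[OF H(1)]] nsq_nonneg[of L "T U"] by linarith
  have S0: "lyap (T (S 0 U)) = lyap (T U)"
    by (rule lyap_cong_AE[OF S_zero[OF H(1)]]) (intro sqint_T S_H H; simp)+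
  \<comment> \<open>From \<open>n0\<close> on the step satisfies \<open>rate * h \<le> 1\<close>, so
    the contraction factor is nonnegative, as the induction and the comparison of powers
    require.\<close>
  obtain n0 where n0: "rate * t \<le> real n0" using real_arch_simple by blast
  have "lyap (T (S t U)) \<le> exp (- rate * t) * lyap (T U) + t * ?e (?h n)" if n: "n \<ge> n0" for n
  proof -
    let ?n = "Suc n"
    define h where "h = ?h n"
    have h: "h > 0" using t by (simp add: h_def)
    have nh: "real ?n * h = t" by (simp add: h_def del: of_nat_Suc)
    have r1: "rate * h \<le> 1"
    proof -
      have "rate * t \<le> real ?n" using n0 n by linarith
      then show ?thesis by (simp add: h_def divide_le_eq del: of_nat_Suc)
    qed
    have gw: "lyap (T (S (real ?n * h) U)) \<le> (1 - rate * h) ^ ?n * lyap (T (S (real 0 * h) U)) + real ?n * (h * ?e h)"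
    proof (rule discrete_gronwall[where f = "\<lambda>k. lyap (T (S (real k * h) U))"])
      fix k
      have "real k * h \<ge> 0" using h by simp
      from decay_step[OF U this h] show "lyap (T (S (real (Suc k) * h) U)) \<le> (1 - rate * h) * lyap (T (S (real k * h) U)) + h * ?e h"
        by (simp add: algebra_simps)
    qed (use h rate_pos r1 in auto)
    have "(1 - rate * h) ^ ?n \<le> exp (- (rate * h)) ^ ?n"
      using r1 exp_ge_add_one_self[of "- (rate * h)"] by (intro power_mono) auto
    also have "exp (- (rate * h)) ^ ?n = exp (- rate * t)"
      unfolding exp_of_nat_mult[symmetric] nh[symmetric] by (simp del: of_nat_Suc)
    finally have le: "(1 - rate * h) ^ ?n * lyap (T U) \<le> exp (- rate * t) * lyap (T U)"
      using l0 by (rule mult_right_mono)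
    have eq: "real ?n * (h * ?e h) = t * ?e h" by (simp only: nh mult.assoc[symmetric])
    have S0': "lyap (T (S (real 0 * h) U)) = lyap (T U)" using S0 by simp
    have "lyap (T (S t U)) \<le> (1 - rate * h) ^ ?n * lyap (T U) + t * ?e h"
      using gw unfolding eq S0' unfolding nh .
    also have "\<dots> \<le> exp (- rate * t) * lyap (T U) + t * ?e h" using le by (rule add_right_mono)
    finally show ?thesis unfolding h_def .
  qed
  then have "\<forall>\<^sub>F n in sequentially. lyap (T (S t U)) \<le> exp (- rate * t) * lyap (T U) + t * ?e (?h n)"
    by (auto simp: eventually_sequentially)
  from tendsto_lowerbound[OF lim this] show ?thesis by simp
qed


section \<open>Density of the domain\<close>

lemma DA_dense:
  assumes U: "U \<in> Hspace L" and e: "e > 0"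
  obtains U' where "U' \<in> DA L kap b k0 l g1 g2 g3" "U' \<in> Hspace L" "nsq L (\<lambda>x. T U x - T U' x) < e"
proof -
  define P where "P = (L + 1)\<^sup>2 * L"
  \<comment> \<open>The coefficient of d in the final estimate. P is the constant of
    \<open>H2_approx\<close>, and \<open>4 + 4 P + 2 l^2 P\<close> comes from splitting the
    three-term strain by \<open>nsq_add\<close> twice. With \<open>d = e / (2 K)\<close> the total
    error is at most \<open>e/2\<close>.\<close>
  define K where "K = kap * (4 + 4 * P + 2 * (l\<^sup>2 * P)) + rho1 + b + rho2 + k0 * (2 + 2 * (l\<^sup>2 * P)) + rho1"
  have P: "P \<ge> 0" using L by (simp add: P_def)
  have K: "K > 0" unfolding K_def using P kap rho1 rho2 k0 b by (intro add_nonneg_pos add_nonneg_nonneg mult_nonneg_nonneg) auto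
  define d where "d = e / (2 * K)"
  have d: "d > 0" using e K by (simp add: d_def)
  obtain \<phi> \<psi> w \<Phi> \<Psi> W where Ueq: "U = (\<phi>,\<psi>,w,\<Phi>,\<Psi>,W)" by (cases U)
  from U have H: "H1 L \<phi>" "H1 L \<psi>" "H1 L w" "\<phi> L = 0" "\<psi> L = 0" "w L = 0" "sqint L \<Phi>" "sqint L \<Psi>" "sqint L W"
    by (auto simp: Ueq Hspace_def H1L_def L2_sqint)
  note wd = H(1-3)[THEN wd_wderiv]
  obtain \<phi>1 p p' where p: "is_wderiv L \<phi>1 p" "is_wderiv L p p'" "\<phi>1 L = 0" "nsq L (\<lambda>x. wd L \<phi> x - p x) \<le> d"
    "nsq L (\<lambda>x. \<phi> x - \<phi>1 x) \<le> P * d" unfolding P_def using H2_approx[OF L wd(1) H(4) d] .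
  obtain \<psi>1 q q' where q: "is_wderiv L \<psi>1 q" "is_wderiv L q q'" "\<psi>1 L = 0" "nsq L (\<lambda>x. wd L \<psi> x - q x) \<le> d"
    "nsq L (\<lambda>x. \<psi> x - \<psi>1 x) \<le> P * d" unfolding P_def using H2_approx[OF L wd(2) H(5) d] .
  obtain w1 r r' where r: "is_wderiv L w1 r" "is_wderiv L r r'" "w1 L = 0" "nsq L (\<lambda>x. wd L w x - r x) \<le> d"
    "nsq L (\<lambda>x. w x - w1 x) \<le> P * d" unfolding P_def using H2_approx[OF L wd(3) H(6) d] .
  \<comment> \<open>The displacements are already fixed. Their strains at 0 dictate the velocities
    at 0, by solving the boundary conditions for the velocities, and \<open>H1_dense\<close>
    realises these values together with the value 0 at L.\<close>
  obtain \<Phi>1 \<Phi>1' where \<Phi>1: "is_wderiv L \<Phi>1 \<Phi>1'" "\<Phi>1 0 = complex_of_real (kap / g1) * (p 0 + \<psi>1 0 + complex_of_real l * w1 0)"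
    "\<Phi>1 L = 0" "nsq L (\<lambda>x. \<Phi> x - \<Phi>1 x) < d"
    using H1_dense[OF L H(7) d] unfolding nsq_def by blast
  obtain \<Psi>1 \<Psi>1' where \<Psi>1: "is_wderiv L \<Psi>1 \<Psi>1'" "\<Psi>1 0 = complex_of_real (b / g2) * q 0"
    "\<Psi>1 L = 0" "nsq L (\<lambda>x. \<Psi> x - \<Psi>1 x) < d"
    using H1_dense[OF L H(8) d] unfolding nsq_def by blast
  obtain W1 W1' where W1: "is_wderiv L W1 W1'" "W1 0 = complex_of_real (k0 / g3) * (r 0 - complex_of_real l * \<phi>1 0)"
    "W1 L = 0" "nsq L (\<lambda>x. W x - W1 x) < d"
    using H1_dense[OF L H(9) d] unfolding nsq_def by blast
  define U' where "U' = (\<phi>1,\<psi>1,w1,\<Phi>1,\<Psi>1,W1)"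
  have sq1: "sqint L \<Phi>1" "sqint L \<Psi>1" "sqint L W1"
    by (rule \<Phi>1(1)[THEN wderiv_continuous, THEN continuous_sqint] \<Psi>1(1)[THEN wderiv_continuous, THEN continuous_sqint]
        W1(1)[THEN wderiv_continuous, THEN continuous_sqint])+
  have UH: "U' \<in> Hspace L"
    unfolding U'_def Hspace_def H1L_def H1_def using p q r sq1 by (auto simp: L2_sqint)
  have UD: "U' \<in> DA L kap b k0 l g1 g2 g3"
    unfolding DA_def U'_def prod.case mem_Collect_eq
  proof (intro conjI)
    show "(\<phi>1,\<psi>1,w1,\<Phi>1,\<Psi>1,W1) \<in> Hspace L" using UH by (simp add: U'_def)
    show "H2 L \<phi>1" "H2 L \<psi>1" "H2 L w1" unfolding H2_def using p q r by blast+
    show "H1L L \<Phi>1" "H1L L \<Psi>1" "H1L L W1" unfolding H1L_def H1_def using \<Phi>1 \<Psi>1 W1 by blast+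
    show "complex_of_real kap * (dval0 L \<phi>1 + \<psi>1 0 + complex_of_real l * w1 0) = complex_of_real g1 * \<Phi>1 0"
      unfolding dval0_eq[OF p(1,2)] \<Phi>1(2) using g1 by simp
    show "complex_of_real b * dval0 L \<psi>1 = complex_of_real g2 * \<Psi>1 0"
      unfolding dval0_eq[OF q(1,2)] \<Psi>1(2) using g2 by simp
    show "complex_of_real k0 * (dval0 L w1 - complex_of_real l * \<phi>1 0) = complex_of_real g3 * W1 0"
      unfolding dval0_eq[OF r(1,2)] W1(2) using g3 by simp
  qed
  define a where "a = (\<lambda>x. wd L \<phi> x - p x)"
  define v where "v = (\<lambda>x. wd L \<psi> x - q x)"
  define c where "c = (\<lambda>x. wd L w x - r x)"
  define da where "da = (\<lambda>x. \<phi> x - \<phi>1 x)"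
  define dv where "dv = (\<lambda>x. \<psi> x - \<psi>1 x)"
  define dc where "dc = (\<lambda>x. w x - w1 x)"
  have wds: "is_wderiv L da a" "is_wderiv L dv v" "is_wderiv L dc c"
    unfolding da_def a_def dv_def v_def dc_def c_def by (intro wderiv_diff wd p q r)+
  note sq = wds[THEN wderiv_sqint] wds[THEN wderiv_continuous, THEN continuous_sqint]
  have n: "nsq L a \<le> d" "nsq L v \<le> d" "nsq L c \<le> d" "nsq L da \<le> P * d" "nsq L dv \<le> P * d" "nsq L dc \<le> P * d"
    using p q r by (simp_all add: a_def v_def c_def da_def dv_def dc_def)
  \<comment> \<open>The difference of the strains \<open>z\<close> is written as a sum with factor
    \<open>- l\<close>, so that \<open>nsq_add\<close> and \<open>nsq_mult\<close> apply to
    it.\<close>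
  have ae: "AE x in leb0 L. T U x - T U' x = pack (a x + dv x + complex_of_real l * dc x) (\<Phi> x - \<Phi>1 x) (v x) (\<Psi> x - \<Psi>1 x)
     (c x + complex_of_real (- l) * da x) (W x - W1 x)"
    using T_AE[OF p(1) q(1) r(1), of \<Phi>1 \<Psi>1 W1]
  proof eventually_elim
    case (elim x)
    show ?case unfolding U'_def elim unfolding Ueq T_def prod.case pack_diff
      by (simp add: a_def v_def c_def da_def dv_def dc_def algebra_simps)
  qed
  have sqs: "sqint L (\<lambda>x. a x + dv x)" "sqint L (\<lambda>x. complex_of_real l * dc x)" "sqint L (\<lambda>x. complex_of_real (- l) * da x)"
    by (intro sqint_add sqint_mult sq)+
  have squ: "sqint L (\<lambda>x. a x + dv x + complex_of_real l * dc x)" "sqint L (\<lambda>x. c x + complex_of_real (- l) * da x)"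
    by (intro sqint_add sqs sq)+
  have sqd: "sqint L (\<lambda>x. \<Phi> x - \<Phi>1 x)" "sqint L (\<lambda>x. \<Psi> x - \<Psi>1 x)" "sqint L (\<lambda>x. W x - W1 x)"
    by (intro sqint_diff H sq1)+
  have l2: "l\<^sup>2 * nsq L f \<le> l\<^sup>2 * P * d" if "nsq L f \<le> P * d" for f :: cfun
    using mult_left_mono[OF that, of "l\<^sup>2"] by (simp add: mult.assoc)
  have nu: "nsq L (\<lambda>x. a x + dv x + complex_of_real l * dc x) \<le> (4 + 4 * P + 2 * (l\<^sup>2 * P)) * d"
    using nsq_add[OF sqs(1,2)] nsq_add[OF sq(1) sq(5)] n l2[OF n(6)] unfolding nsq_mult by (simp add: algebra_simps)
  have nz: "nsq L (\<lambda>x. c x + complex_of_real (- l) * da x) \<le> (2 + 2 * (l\<^sup>2 * P)) * d"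
    using nsq_add[OF sq(3) sqs(3)] n l2[OF n(4)] unfolding nsq_mult by (simp add: algebra_simps)
  have sqp: "sqint L (\<lambda>x. pack (a x + dv x + complex_of_real l * dc x) (\<Phi> x - \<Phi>1 x) (v x) (\<Psi> x - \<Psi>1 x)
     (c x + complex_of_real (- l) * da x) (W x - W1 x))"
    unfolding pack_def by (intro sqint_Pair sqint_scaleR squ sqd sq)
  have "nsq L (\<lambda>x. T U x - T U' x) = nsq L (\<lambda>x. pack (a x + dv x + complex_of_real l * dc x) (\<Phi> x - \<Phi>1 x) (v x) (\<Psi> x - \<Psi>1 x)
     (c x + complex_of_real (- l) * da x) (W x - W1 x))"
    by (rule nsq_cong_AE[OF ae sqint_diff[OF sqint_T[OF U] sqint_T[OF UH]] sqp])
  also have "\<dots> = kap * nsq L (\<lambda>x. a x + dv x + complex_of_real l * dc x) + rho1 * nsq L (\<lambda>x. \<Phi> x - \<Phi>1 x) + b * nsq L v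
     + rho2 * nsq L (\<lambda>x. \<Psi> x - \<Psi>1 x) + k0 * nsq L (\<lambda>x. c x + complex_of_real (- l) * da x) + rho1 * nsq L (\<lambda>x. W x - W1 x)"
    by (rule nsq_pack[OF squ(1) sqd(1) sq(2) sqd(2) squ(2) sqd(3)])
  also have "\<dots> \<le> kap * ((4 + 4 * P + 2 * (l\<^sup>2 * P)) * d) + rho1 * d + b * d + rho2 * d + k0 * ((2 + 2 * (l\<^sup>2 * P)) * d) + rho1 * d"
    using nu nz n \<Phi>1(4) \<Psi>1(4) W1(4) kap rho1 rho2 b k0 by (intro add_mono mult_left_mono) auto
  also have "\<dots> = K * d" by (simp add: K_def algebra_simps)
  also have "\<dots> < e" using K e by (simp add: d_def)
  finally show ?thesis using that[OF UD UH] by simp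
qed

end

section \<open>Decay for all initial states\<close>

context bresse_semigroup
begin

text \<open>The decay of the functional is known on the domain, and contractivity controls the orbit
  of the approximation error. The constant 16 consists of four factors 2: two comparisons of the
  squared norm with the functional and two splittings by \<open>nsq_add\<close>.\<close>

lemma decay:
  assumes U: "U \<in> Hspace L" and t: "t \<ge> 0"
  shows "nsq L (T (S t U)) \<le> 16 * exp (- rate * t) * nsq L (T U)"
proof (cases "t = 0")
  case True
  have "nsq L (T (S t U)) \<le> nsq L (T U)" by (rule S_nsq[OF t U])
  also have "\<dots> \<le> 16 * nsq L (T U)" using nsq_nonneg[of L "T U"] by linarith
  finally show ?thesis by (simp add: True)
next
  case False
  with t have t': "t > 0" by simp
  have E: "exp (- rate * t) \<le> 1" "exp (- rate * t) \<ge> 0" using rate_pos t by auto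
  show ?thesis
  proof (rule field_le_epsilon)
    fix e :: real assume e: "e > 0"
    \<comment> \<open>Replacing \<open>T U'\<close> by \<open>T U\<close> costs 16 shares of the
      error and the orbit of the difference costs 2, hence 18.\<close>
    then have "e / 18 > 0" by simp
    then obtain U' where U': "U' \<in> D" "U' \<in> Hspace L" "nsq L (\<lambda>x. T U x - T U' x) < e / 18"
      by (rule DA_dense[OF U])
    have sd: "sqint L (\<lambda>x. T U x - T U' x)" by (intro sqint_diff sqint_T U U')
    note Q = st_sub_H[OF U U'(2)]
    have Qn: "nsq L (T (st_sub U U')) < e / 18"
      using U'(3) nsq_cong_AE[OF T_sub[OF U U'(2)] sqint_T[OF Q] sd] by simp
    have ss: "sqint L (T (S t U'))" "sqint L (T (S t (st_sub U U')))" by (intro sqint_T S_H t U' Q)+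
    have "nsq L (T (S t U)) = nsq L (\<lambda>x. T (S t U') x + T (S t (st_sub U U')) x)"
    proof (rule nsq_cong_AE)
      show "AE x in leb0 L. T (S t U) x = T (S t U') x + T (S t (st_sub U U')) x"
        using S_sub[OF t U U'(2)] by eventually_elim simp
    qed (intro sqint_add ss sqint_T S_H t U)+
    also have "\<dots> \<le> 2 * nsq L (T (S t U')) + 2 * nsq L (T (S t (st_sub U U')))" by (rule nsq_add[OF ss])
    also have "nsq L (T (S t U')) \<le> 2 * lyap (T (S t U'))" by (rule lyap_bounds(1)[OF ss(1)])
    also have "lyap (T (S t U')) \<le> exp (- rate * t) * lyap (T U')" by (rule decay_D[OF U'(1) t'])
    also have "lyap (T U') \<le> 2 * nsq L (T U')" by (rule lyap_bounds(2)[OF sqint_T[OF U'(2)]])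
    also have "nsq L (T U') \<le> 2 * nsq L (T U) + 2 * (e / 18)"
    proof -
      have "nsq L (\<lambda>x. T U x + (- 1) *\<^sub>R (T U x - T U' x)) \<le> 2 * nsq L (T U) + 2 * nsq L (\<lambda>x. (- 1) *\<^sub>R (T U x - T U' x))"
        by (intro nsq_add sqint_scaleR sd sqint_T U)
      also have "(\<lambda>x. T U x + (- 1) *\<^sub>R (T U x - T U' x)) = T U'" by auto
      also have "nsq L (\<lambda>x. (- 1) *\<^sub>R (T U x - T U' x)) = nsq L (\<lambda>x. T U x - T U' x)"
        unfolding nsq_def by (simp add: norm_minus_commute)
      finally show ?thesis using U'(3) by simp
    qed
    also have "nsq L (T (S t (st_sub U U'))) \<le> e / 18" using S_nsq[OF t Q] Qn by simp
    finally have "nsq L (T (S t U)) \<le> 16 * exp (- rate * t) * nsq L (T U) + (16 * (exp (- rate * t) * (e / 18)) + 2 * (e / 18))"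
      using E by (simp add: algebra_simps)
    moreover have "exp (- rate * t) * (e / 18) \<le> 1 * (e / 18)" using E e by (intro mult_right_mono) auto
    ultimately show "nsq L (T (S t U)) \<le> 16 * exp (- rate * t) * nsq L (T U) + e" by linarith
  qed
qed

lemma exponential_stability:
  assumes U: "U \<in> Hspace L" and t: "t \<ge> 0"
  shows "N (S t U) \<le> 4 * exp (- (rate / 2) * t) * N U"
proof (rule power2_le_imp_le)
  \<comment> \<open>Passing from squared norms to norms turns 16 into 4 and halves the rate.\<close>
  have "(4 * exp (- (rate / 2) * t) * N U)\<^sup>2 = 16 * exp (- rate * t) * (N U)\<^sup>2"
    by (simp add: power_mult_distrib flip: exp_double)
  then show "(N (S t U))\<^sup>2 \<le> (4 * exp (- (rate / 2) * t) * N U)\<^sup>2"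
    using decay[OF U t] by (simp only: N_sq[OF U] N_sq[OF S_H[OF t U]])
  show "0 \<le> 4 * exp (- (rate / 2) * t) * N U" using N_nonneg[OF U] by simp
qed

end

theorem theorem3p4:
  fixes L rho1 rho2 kap b k0 l g1 g2 g3 :: real
    and S :: "real \<Rightarrow> state \<Rightarrow> state"
  assumes "L > 0" "rho1 > 0" "rho2 > 0" "kap > 0" "b > 0" "k0 > 0" "l > 0"
    and "g1 > 0" "g2 > 0" "g3 > 0"
    and "C0_contraction_semigroup (Hspace L) (Hnorm L rho1 rho2 kap b k0 l) S"
    and "has_generator (Hspace L) (Hnorm L rho1 rho2 kap b k0 l) S
           (DA L kap b k0 l g1 g2 g3) (Aop L rho1 rho2 kap b k0 l)"
  shows "\<exists>M>0. \<exists>\<mu>>0. \<forall>t\<ge>0. \<forall>U\<in>Hspace L.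
           Hnorm L rho1 rho2 kap b k0 l (S t U) \<le> M * exp (- \<mu> * t) * Hnorm L rho1 rho2 kap b k0 l U"
proof -
  interpret bresse_semigroup L rho1 rho2 kap b k0 l g1 g2 g3 S
    by unfold_locales (fact assms)+
  have "4 > (0::real)" "rate / 2 > 0" using rate_pos by auto
  then show ?thesis using exponential_stability by blast
qed

end
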